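(* Let $1<\alpha<2$, $C=\left(\cos\left(\pi\left(\tfrac{\alpha}{2}-1\right)\right)\right)^{-1}$ and $\beta=(\alpha-1)^{-1}$. Let $J$ be a spectrally positive $\alpha$-stable Lévy motion, normalized so that $\log\mathbb{E}\,e^{-s(J_1-\mathbb{E}J_1)}=Cs^{\alpha}$ for $s\ge0$. Fix $r>0$ and, for $0<\epsilon<r$, consider the fluid tandem queue with input $J$ and service rates $r_1=\mathbb{E}J_1+r$ and $r_2=\mathbb{E}J_1+\epsilon$, with stationary workloads $(Q^{(1)},Q^{(2)})$. Then for all $s_1,s_2\ge0$, $$\lim_{\epsilon\downarrow0}\mathbb{E}\,e^{-s_1(r/C)^{\beta}Q^{(1)}-s_2(\epsilon/C)^{\beta}Q^{(2)}}=\frac{1}{1+s_1^{\alpha-1}}\cdot\frac{1}{1+s_2^{\alpha-1}}.$$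
   Context: Fluid tandem queue: $J=\{J_t,t\ge 0\}$ is a spectrally positive Lévy process (no negative jumps), $J_0=0$, $\mathbb{E}|J_1|<\infty$. Two servers in series work at constant rates $r_1>r_2>\mathbb{E}J_1$. The input $J$ feeds the first (upstream) queue, whose server empties it at rate $r_1$; its output flows continuously into the second (downstream) queue, which is emptied at rate $r_2$. Formally, for $i=1,2$ let $X^{(i)}_t=J_t-r_it$ and $L^{(i)}_t=-\inf_{0\le s\le t}X^{(i)}_s$. Starting empty, the upstream workload is $Q^{(1)}_t=X^{(1)}_t+L^{(1)}_t$, the total workload is $Q^{(1)}_t+Q^{(2)}_t=X^{(2)}_t+L^{(2)}_t$, and hence the downstream workload is $Q^{(2)}_t=X^{(2)}_t+L^{(2)}_t-Q^{(1)}_t$. The pair $(Q^{(1)},Q^{(2)})$ denotes the steady-state workloads, i.e. a random vector whose law is the limit in distribution of $(Q^{(1)}_t,Q^{(2)}_t)$ as $t\to\infty$. *)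

theory Defs
  imports "HOL-Probability.Probability"
begin

text \<open>Time is modelled by the type \<^typ>\<open>real\<close>; only values at times \<open>t \<ge> 0\<close> matter. All sample
  paths start in \<open>0\<close> and are right-continuous with left limits, so that functionals of the whole
  path, such as running infima, are random variables on any probability space.\<close>

locale levy_process = prob_space M for M :: "'a measure" +
  fixes J :: "real \<Rightarrow> 'a \<Rightarrow> real"
  assumes random_variable_J: "\<And>t. 0 \<le> t \<Longrightarrow> random_variable borel (J t)"
    and start_zero: "\<And>\<omega>. \<omega> \<in> space M \<Longrightarrow> J 0 \<omega> = 0"
    and independent_increments: "\<And>(n::nat) (t :: nat \<Rightarrow> real).
      0 \<le> t 0 \<Longrightarrow> (\<And>i. i < n \<Longrightarrow> t i \<le> t (Suc i)) \<Longrightarrow>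
      indep_vars (\<lambda>_. borel) (\<lambda>i \<omega>. J (t (Suc i)) \<omega> - J (t i) \<omega>) {..<n}"
    and stationary_increments: "\<And>s t. 0 \<le> s \<Longrightarrow> s \<le> t \<Longrightarrow>
      distr M borel (\<lambda>\<omega>. J t \<omega> - J s \<omega>) = distr M borel (J (t - s))"
    and right_continuous: "\<And>\<omega> t. \<omega> \<in> space M \<Longrightarrow> 0 \<le> t \<Longrightarrow>
      continuous (at_right t) (\<lambda>s. J s \<omega>)"
    and left_limits: "\<And>\<omega> t. \<omega> \<in> space M \<Longrightarrow> 0 < t \<Longrightarrow>
      \<exists>l. ((\<lambda>s. J s \<omega>) \<longlongrightarrow> l) (at_left t)"

definition no_negative_jumps :: "'a measure \<Rightarrow> (real \<Rightarrow> 'a \<Rightarrow> real) \<Rightarrow> bool" where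
  "no_negative_jumps M J \<longleftrightarrow>
     (AE \<omega> in M. \<forall>t>0. \<forall>l. ((\<lambda>s. J s \<omega>) \<longlongrightarrow> l) (at_left t) \<longrightarrow> l \<le> J t \<omega>)"

definition spectrally_positive_levy :: "'a measure \<Rightarrow> (real \<Rightarrow> 'a \<Rightarrow> real) \<Rightarrow> bool" where
  "spectrally_positive_levy M J \<longleftrightarrow> levy_process M J \<and> no_negative_jumps M J"

text \<open>A Levy process is \<open>\<alpha>\<close>-stable if it is not deterministic and, for every \<open>a > 0\<close>, the processes
  \<open>(J\<^sub>a\<^sub>t)\<close> and \<open>(a\<^bsup>1/\<alpha>\<^esup> J\<^sub>t + c t)\<close> have the same finite-dimensional distributions for some \<open>c\<close>. The
  drift \<open>c\<close> is needed because \<open>J\<close> is not assumed to be centred.\<close>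

definition stable_levy_motion :: "'a measure \<Rightarrow> real \<Rightarrow> (real \<Rightarrow> 'a \<Rightarrow> real) \<Rightarrow> bool" where
  "stable_levy_motion M \<alpha> J \<longleftrightarrow>
     levy_process M J \<and>
     \<not> (\<exists>x. AE \<omega> in M. J 1 \<omega> = x) \<and>
     (\<forall>a>0. \<exists>c. \<forall>T. finite T \<and> T \<subseteq> {0..} \<longrightarrow>
        distr M (PiM T (\<lambda>_. borel)) (\<lambda>\<omega>. \<lambda>t\<in>T. J (a * t) \<omega>) =
        distr M (PiM T (\<lambda>_. borel)) (\<lambda>\<omega>. \<lambda>t\<in>T. a powr (1 / \<alpha>) * J t \<omega> + c * t))"

definition net_input :: "(real \<Rightarrow> 'a \<Rightarrow> real) \<Rightarrow> real \<Rightarrow> real \<Rightarrow> 'a \<Rightarrow> real" where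
  "net_input J r t \<omega> = J t \<omega> - r * t"

definition regulator :: "(real \<Rightarrow> 'a \<Rightarrow> real) \<Rightarrow> real \<Rightarrow> real \<Rightarrow> 'a \<Rightarrow> real" where
  "regulator J r t \<omega> = - (INF s\<in>{0..t}. net_input J r s \<omega>)"

definition upstream_workload :: "(real \<Rightarrow> 'a \<Rightarrow> real) \<Rightarrow> real \<Rightarrow> real \<Rightarrow> 'a \<Rightarrow> real" where
  "upstream_workload J r1 t \<omega> = net_input J r1 t \<omega> + regulator J r1 t \<omega>"

definition downstream_workload ::
    "(real \<Rightarrow> 'a \<Rightarrow> real) \<Rightarrow> real \<Rightarrow> real \<Rightarrow> real \<Rightarrow> 'a \<Rightarrow> real" where
  "downstream_workload J r1 r2 t \<omega> =
     net_input J r2 t \<omega> + regulator J r2 t \<omega> - upstream_workload J r1 t \<omega>"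

text \<open>Convergence in distribution of \<open>X t\<close> to \<open>Y\<close> as \<open>t \<rightarrow> \<infinity>\<close>. The random elements \<open>X t\<close> and \<open>Y\<close> may
  live on different probability spaces.\<close>

definition converges_in_distribution ::
    "'a measure \<Rightarrow> (real \<Rightarrow> 'a \<Rightarrow> 'c::topological_space) \<Rightarrow> 'b measure \<Rightarrow> ('b \<Rightarrow> 'c) \<Rightarrow> bool" where
  "converges_in_distribution M X N Y \<longleftrightarrow>
     (\<forall>f :: 'c \<Rightarrow> real. continuous_on UNIV f \<and> bounded (range f) \<longrightarrow>
        ((\<lambda>t. \<integral>\<omega>. f (X t \<omega>) \<partial>M) \<longlongrightarrow> (\<integral>\<omega>. f (Y \<omega>) \<partial>N)) at_top)"

text \<open>\<open>(Q1, Q2)\<close>, defined on the probability space \<open>N\<close>, is a version of the steady-state workloads of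
  the tandem queue with input \<open>J\<close> and service rates \<open>r1\<close>, \<open>r2\<close>.\<close>

definition stationary_workloads ::
    "'a measure \<Rightarrow> (real \<Rightarrow> 'a \<Rightarrow> real) \<Rightarrow> real \<Rightarrow> real \<Rightarrow>
     'b measure \<Rightarrow> ('b \<Rightarrow> real) \<Rightarrow> ('b \<Rightarrow> real) \<Rightarrow> bool" where
  "stationary_workloads M J r1 r2 N Q1 Q2 \<longleftrightarrow>
     prob_space N \<and> Q1 \<in> borel_measurable N \<and> Q2 \<in> borel_measurable N \<and>
     converges_in_distribution
       M (\<lambda>t \<omega>. (upstream_workload J r1 t \<omega>, downstream_workload J r1 r2 t \<omega>))
       N (\<lambda>\<omega>. (Q1 \<omega>, Q2 \<omega>))"

end

theory Submission
  imports Defs "HOL-Real_Asymp.Real_Asymp"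
begin

text \<open>The two workloads separate because they live on different time scales. The upstream queue forgets
its past after a time of order one. The total content of the system, which is a single queue
served at the slower rate \<open>r2 = m + \<epsilon>\<close> where \<open>m\<close> is the mean input rate, has content of order
\<open>\<epsilon>\<close> to the power \<open>-\<beta>\<close> and does not notice, on that scale, what happened in a time window of fixed
length \<open>T\<close>. So at a late time \<open>t\<close> the upstream workload may be replaced by the one built from the
input after \<open>t - T\<close> only, and the total workload by its value at \<open>t - T\<close>. These two are independent.
Moreover the downstream workload differs from the total one by the upstream workload, which is
negligible after scaling. It remains to know the two marginal laws.

All replacement errors are compared in the Laplace domain, where each of them is a difference of two
ordered exponentials. Its expectation is then an explicit expression in the transforms of the single
queues (\<open>asymptotic_independence_bound\<close>, \<open>joint_transform_bound\<close>).

The marginals are given by the Pollaczek-Khinchine formula \<open>A s = r s / (r s + C s\<^sup>\<alpha>)\<close> for a queue with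
service rate \<open>m + r\<close>, with \<open>s\<^sup>\<alpha>\<close> standing for \<open>s powr \<alpha>\<close> (\<open>stable_pollaczek_khinchine\<close>). Under the
scaling of the theorem it becomes \<open>1 / (1 + s powr (\<alpha> - 1))\<close> for every value of the rate, so no
limit is involved in either marginal. The formula is proved on dyadic time grids, where the workload
satisfies the Lindley recursion. For a grid of mesh \<open>h\<close>, let \<open>g\<close> be the transform of one net increment
and \<open>z\<close> the idle amount in one step. The recursion gives the balance
\<open>A s * (g s - 1) = E (exp (s z) - 1)\<close> in the long run. Divided by \<open>h\<close>, the left side tends to
\<open>A s * (r s + C s\<^sup>\<alpha>)\<close>. On the right side, \<open>exp (s z) - 1\<close> may be replaced by \<open>s z\<close>: the idle amount is
at most the negative part of an increment, which has size \<open>h\<close> to the power \<open>1 / \<alpha>\<close> with exponential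
tails, and \<open>2 / \<alpha> > 1\<close> makes the quadratic error \<open>o(h)\<close>. Hence \<open>A s * (r s + C s\<^sup>\<alpha>) = s \<mu>\<close> with \<open>\<mu>\<close>
independent of \<open>s\<close>, and \<open>\<mu> = r\<close> follows from \<open>A s \<longlongrightarrow> 1\<close> as \<open>s\<close> decreases to zero, which expresses that
the stationary workload is finite.\<close>

section \<open>The Lindley recursion\<close>

primrec reflect :: "(nat \<Rightarrow> real) \<Rightarrow> nat \<Rightarrow> real" where
  "reflect x 0 = 0"
| "reflect x (Suc n) = max (reflect x n + x n) 0"

lemma reflect_nonneg: "0 \<le> reflect x n"
  by (cases n) auto

lemma reflect_cong: "(\<And>k. k < n \<Longrightarrow> x k = y k) \<Longrightarrow> reflect x n = reflect y n"
  by (induction n) auto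

lemma reflect_mono: "(\<And>k. k < n \<Longrightarrow> x k \<le> y k) \<Longrightarrow> reflect x n \<le> reflect y n"
proof (induction n)
  case (Suc n)
  then have "reflect x n \<le> reflect y n" "x n \<le> y n" by auto
  then show ?case by simp
qed simp

text \<open>Monotonicity of the recursion in its state: a queue that is empty at step \<open>u\<close> stays below one that
has a history, and a history can raise the content at any later time by at most its content at \<open>u\<close>.\<close>

lemma reflect_shift_le: "reflect (\<lambda>k. x (u + k)) n \<le> reflect x (u + n)"
  by (induction n) (auto simp: reflect_nonneg)

lemma reflect_le_add: "reflect x (u + n) \<le> reflect x u + reflect (\<lambda>k. x (u + k)) n"
  by (induction n) (use reflect_nonneg[of x u] in auto)

text \<open>The recursion in closed form, which identifies it with the regulated process of the continuous
model on a grid.\<close>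

lemma reflect_increments:
  "reflect (\<lambda>k. S (Suc k) - S k) n = S n - Min (S ` {..n})"
proof (induction n)
  case (Suc n)
  have "Min (S ` {..Suc n}) = min (S (Suc n)) (Min (S ` {..n}))"
    by (simp add: atMost_Suc)
  moreover have "S (Suc n) - min (S (Suc n)) m = max (S n - m + (S (Suc n) - S n)) 0" for m
    by (simp add: min_def max_def)
  ultimately show ?case using Suc by (simp only: reflect.simps)
qed simp

lemma exp_second_order:
  fixes x :: real assumes "0 \<le> x" shows "exp x - 1 - x \<le> x\<^sup>2 / 2 * exp x"
proof -
  obtain t where t: "\<bar>t\<bar> \<le> \<bar>x\<bar>" "exp x = (\<Sum>m<2. x ^ m / fact m) + exp t / fact 2 * x ^ 2"
    using Maclaurin_exp_le[of x 2] by auto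
  then have "exp x - 1 - x = exp t / 2 * x\<^sup>2" by (simp add: numeral_2_eq_2)
  also have "\<dots> \<le> exp x / 2 * x\<^sup>2"
    using t(1) assms by (intro mult_right_mono divide_right_mono) auto
  finally show ?thesis by (simp add: mult.commute)
qed

section \<open>Reflected random walks\<close>

lemma (in prob_space) indep_vars_reindex:
  assumes f: "inj_on f I" and X: "indep_vars M' X (f ` I)"
  shows "indep_vars (\<lambda>i. M' (f i)) (\<lambda>i. X (f i)) I"
  unfolding indep_vars_def2 indep_sets_def
proof (intro conjI ballI allI impI)
  let ?F = "\<lambda>i. {X i -` A \<inter> space M |A. A \<in> sets (M' i)}"
  have rv: "\<And>i. i \<in> I \<Longrightarrow> X (f i) \<in> measurable M (M' (f i))"
    using X unfolding indep_vars_def2 by auto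
  fix i assume "i \<in> I"
  then show "X (f i) \<in> measurable M (M' (f i))" by (rule rv)
  show "?F (f i) \<subseteq> events" using rv[OF \<open>i \<in> I\<close>] by auto
next
  let ?F = "\<lambda>i. {X i -` A \<inter> space M |A. A \<in> sets (M' i)}"
  have ind: "indep_sets ?F (f ` I)"
    using X unfolding indep_vars_def2 by auto
  fix J A assume J: "J \<subseteq> I" "J \<noteq> {}" "finite J" and A: "A \<in> (\<Pi> j\<in>J. ?F (f j))"
  have inv: "the_inv_into J f (f j) = j" if "j \<in> J" for j
    using inj_on_subset[OF f J(1)] that by (rule the_inv_into_f_f)
  have "prob (\<Inter>j\<in>f ` J. A (the_inv_into J f j)) = (\<Prod>j\<in>f ` J. prob (A (the_inv_into J f j)))"
  proof (rule indep_setsD[OF ind])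
    show "\<forall>j\<in>f ` J. A (the_inv_into J f j) \<in> ?F j"
      using A inv by auto
  qed (use J in auto)
  then show "prob (\<Inter> (A ` J)) = (\<Prod>j\<in>J. prob (A j))"
    using inv by (simp add: prod.reindex[OF inj_on_subset[OF f J(1)]])
qed

locale iid_sequence = prob_space M for M :: "'a measure" +
  fixes \<eta> :: "nat \<Rightarrow> 'a \<Rightarrow> real"
  assumes independent: "indep_vars (\<lambda>_. borel) \<eta> UNIV"
    and identical: "\<And>k. distr M borel (\<eta> k) = distr M borel (\<eta> 0)"
begin

lemma measurable_\<eta> [measurable]: "random_variable borel (\<eta> k)"
  using independent unfolding indep_vars_def by auto

text \<open>The content after \<open>n\<close> steps of a queue that is served at rate \<open>c\<close> and is empty at step \<open>u\<close>. The
starting time is a parameter because the independence argument compares queues started at different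
times and fed by the same input.\<close>

definition queue :: "real \<Rightarrow> nat \<Rightarrow> nat \<Rightarrow> 'a \<Rightarrow> real" where
  "queue c u n \<omega> = reflect (\<lambda>k. \<eta> (u + k) \<omega> - c) n"

definition laplace :: "real \<Rightarrow> real \<Rightarrow> nat \<Rightarrow> real" where
  "laplace c s n = expectation (\<lambda>\<omega>. exp (- (s * queue c 0 n \<omega>)))"

lemma queue_nonneg: "0 \<le> queue c u n \<omega>"
  by (simp add: queue_def reflect_nonneg)

lemma measurable_queue [measurable]: "random_variable borel (queue c u n)"
proof -
  have "(\<lambda>\<omega>. reflect (\<lambda>k. \<eta> (u + k) \<omega> - c) n) \<in> borel_measurable M"
    by (induction n) auto
  then show ?thesis unfolding queue_def .
qed

lemma measurable_reflect_PiM: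
  assumes "{u..<u + m} \<subseteq> I"
  shows "(\<lambda>x. reflect (\<lambda>k. x (u + k) - c) m) \<in> borel_measurable (PiM I (\<lambda>_. borel))"
  using assms
proof (induction m)
  case (Suc m)
  have "u + m \<in> I" using Suc.prems by auto
  then have [measurable]: "(\<lambda>x. x (u + m)) \<in> borel_measurable (PiM I (\<lambda>_. borel))"
    by measurable
  have [measurable]: "(\<lambda>x. reflect (\<lambda>k. x (u + k) - c) m) \<in> borel_measurable (PiM I (\<lambda>_. borel))"
    using Suc by (auto simp: subset_eq)
  show ?case by simp
qed simp

text \<open>Stationarity of the increments, in the form needed for path functionals: any \<open>n\<close> consecutive
increments have the same product law.\<close>

lemma expectation_shift:
  fixes F :: "(nat \<Rightarrow> real) \<Rightarrow> real"
  assumes F: "F \<in> borel_measurable (PiM {..<n} (\<lambda>_. borel))"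
  shows "expectation (\<lambda>\<omega>. F (\<lambda>k\<in>{..<n}. \<eta> (u + k) \<omega>)) = expectation (\<lambda>\<omega>. F (\<lambda>k\<in>{..<n}. \<eta> k \<omega>))"
proof (cases "n = 0")
  case False
  define P where "P = PiM {..<n} (\<lambda>_. borel :: real measure)"
  have law: "distr M P (\<lambda>\<omega>. \<lambda>k\<in>{..<n}. \<eta> (v + k) \<omega>) = PiM {..<n} (\<lambda>_. distr M borel (\<eta> 0))" for v
  proof -
    have "indep_vars (\<lambda>_. borel) \<eta> {v..<v + n}"
      using independent by (rule indep_vars_subset) simp
    then have "indep_vars (\<lambda>_. borel) (\<lambda>k. \<eta> (v + k)) {..<n}"
      using indep_vars_reindex[of "(+) v" "{..<n}" "\<lambda>_. borel" \<eta>]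
      by (simp add: lessThan_atLeast0 add.commute[of n v])
    then have "distr M P (\<lambda>\<omega>. \<lambda>k\<in>{..<n}. \<eta> (v + k) \<omega>) = PiM {..<n} (\<lambda>k. distr M borel (\<eta> (v + k)))"
      unfolding P_def by (subst (asm) indep_vars_iff_distr_eq_PiM') (use False in auto)
    also have "\<dots> = PiM {..<n} (\<lambda>_. distr M borel (\<eta> 0))"
      by (intro PiM_cong identical refl)
    finally show ?thesis .
  qed
  have "expectation (\<lambda>\<omega>. F (\<lambda>k\<in>{..<n}. \<eta> (v + k) \<omega>)) = integral\<^sup>L (distr M P (\<lambda>\<omega>. \<lambda>k\<in>{..<n}. \<eta> (v + k) \<omega>)) F" for v
    unfolding P_def by (subst integral_distr) (use F in \<open>auto intro!: measurable_restrict\<close>)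
  from this[of u] this[of 0] law[of u] law[of 0] show ?thesis by simp
qed (simp add: restrict_def)

lemma laplace_shift: "expectation (\<lambda>\<omega>. exp (- (s * queue c u n \<omega>))) = laplace c s n"
proof -
  have [measurable]: "(\<lambda>x. reflect (\<lambda>k. x k - c) n) \<in> borel_measurable (PiM {..<n} (\<lambda>_. borel))"
    using measurable_reflect_PiM[of 0 n "{..<n}" c] by (simp add: lessThan_atLeast0)
  have meas: "(\<lambda>x. exp (- (s * reflect (\<lambda>k. x k - c) n))) \<in> borel_measurable (PiM {..<n} (\<lambda>_. borel))"
    by measurable
  have q: "reflect (\<lambda>k. (\<lambda>k\<in>{..<n}. \<eta> (v + k) \<omega>) k - c) n = queue c v n \<omega>" for v \<omega>
    unfolding queue_def by (rule reflect_cong) simp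
  then show ?thesis
    using expectation_shift[OF meas, of u] q[of u] q[of 0] by (simp add: laplace_def)
qed

lemma indep_queue:
  "indep_var borel (queue c u n) borel (queue c' 0 u)"
proof -
  have "indep_var (PiM {u..<u+n} (\<lambda>_. borel)) (\<lambda>\<omega>. restrict (\<lambda>i. \<eta> i \<omega>) {u..<u+n})
     (PiM {..<u} (\<lambda>_. borel)) (\<lambda>\<omega>. restrict (\<lambda>i. \<eta> i \<omega>) {..<u})"
    by (rule indep_var_restrict[OF independent]) auto
  then have "indep_var borel ((\<lambda>x. reflect (\<lambda>k. x (u + k) - c) n) \<circ> (\<lambda>\<omega>. restrict (\<lambda>i. \<eta> i \<omega>) {u..<u+n}))
     borel ((\<lambda>x. reflect (\<lambda>k. x (0 + k) - c') u) \<circ> (\<lambda>\<omega>. restrict (\<lambda>i. \<eta> i \<omega>) {..<u}))"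
    by (rule indep_var_compose) (intro measurable_reflect_PiM; auto)+
  also have "(\<lambda>x. reflect (\<lambda>k. x (u + k) - c) n) \<circ> (\<lambda>\<omega>. restrict (\<lambda>i. \<eta> i \<omega>) {u..<u+n}) = queue c u n"
    by (auto simp: queue_def fun_eq_iff intro!: reflect_cong)
  also have "(\<lambda>x. reflect (\<lambda>k. x (0 + k) - c') u) \<circ> (\<lambda>\<omega>. restrict (\<lambda>i. \<eta> i \<omega>) {..<u}) = queue c' 0 u"
    by (auto simp: queue_def fun_eq_iff intro!: reflect_cong)
  finally show ?thesis .
qed

lemma indep_queue_increment: "indep_var borel (queue c 0 n) borel (\<eta> n)"
proof -
  have "indep_var (PiM {..<n} (\<lambda>_. borel)) (\<lambda>\<omega>. restrict (\<lambda>i. \<eta> i \<omega>) {..<n})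
     (PiM {n} (\<lambda>_. borel)) (\<lambda>\<omega>. restrict (\<lambda>i. \<eta> i \<omega>) {n})"
    by (rule indep_var_restrict[OF independent]) auto
  then have "indep_var borel ((\<lambda>x. reflect (\<lambda>k. x (0 + k) - c) n) \<circ> (\<lambda>\<omega>. restrict (\<lambda>i. \<eta> i \<omega>) {..<n}))
     borel ((\<lambda>x. x n) \<circ> (\<lambda>\<omega>. restrict (\<lambda>i. \<eta> i \<omega>) {n}))"
    by (rule indep_var_compose) (intro measurable_reflect_PiM, auto)
  also have "(\<lambda>x. x n) \<circ> (\<lambda>\<omega>. restrict (\<lambda>i. \<eta> i \<omega>) {n}) = \<eta> n"
    by (auto simp: fun_eq_iff)
  also have "(\<lambda>x. reflect (\<lambda>k. x (0 + k) - c) n) \<circ> (\<lambda>\<omega>. restrict (\<lambda>i. \<eta> i \<omega>) {..<n}) = queue c 0 n"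
    by (auto simp: queue_def fun_eq_iff intro!: reflect_cong)
  finally show ?thesis .
qed

lemma integrable_exp_queue [simp]: "0 \<le> s \<Longrightarrow> integrable M (\<lambda>\<omega>. exp (- (s * queue c u n \<omega>)))"
  by (rule integrable_const_bound[where B=1]) (auto simp: queue_nonneg)

lemma laplace_nonneg: "0 \<le> laplace c s n"
  unfolding laplace_def by simp

lemma queue_shift_le: "queue c u n \<omega> \<le> queue c 0 (u + n) \<omega>"
  using reflect_shift_le[of "\<lambda>k. \<eta> k \<omega> - c" u n] by (simp add: queue_def)

lemma queue_le_add: "queue c 0 (u + n) \<omega> \<le> queue c 0 u \<omega> + queue c u n \<omega>"
  using reflect_le_add[of "\<lambda>k. \<eta> k \<omega> - c" u n] by (simp add: queue_def)

lemma queue_antimono: "c2 \<le> c1 \<Longrightarrow> queue c1 u n \<omega> \<le> queue c2 u n \<omega>"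
  unfolding queue_def by (rule reflect_mono) simp

text \<open>In law, discarding the first increment changes \<open>Suc n\<close> steps into \<open>n\<close> steps, and pathwise it lowers
the content.\<close>

lemma decseq_laplace: assumes "0 \<le> s" shows "decseq (laplace c s)"
proof (rule decseq_SucI)
  fix n
  have "laplace c s (Suc n) \<le> expectation (\<lambda>\<omega>. exp (- (s * queue c 1 n \<omega>)))"
    unfolding laplace_def
  proof (rule integral_mono)
    fix \<omega>
    show "exp (- (s * queue c 0 (Suc n) \<omega>)) \<le> exp (- (s * queue c 1 n \<omega>))"
      using queue_shift_le[of c 1 n \<omega>] assms by (simp add: mult_left_mono)
  qed (use assms in auto)
  then show "laplace c s (Suc n) \<le> laplace c s n" by (simp only: laplace_shift)
qed

text \<open>The queue started at \<open>u\<close> only uses increments from \<open>u\<close> on, the other queue only earlier ones.\<close>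

lemma laplace_indep:
  assumes "0 \<le> s" "0 \<le> s'"
  shows "expectation (\<lambda>\<omega>. exp (- (s * queue c u n \<omega>)) * exp (- (s' * queue c' 0 u \<omega>))) = laplace c s n * laplace c' s' u"
proof -
  have "indep_var borel ((\<lambda>x. exp (- (s * x))) \<circ> queue c u n) borel ((\<lambda>x. exp (- (s' * x))) \<circ> queue c' 0 u)"
    by (rule indep_var_compose[OF indep_queue]) auto
  from indep_var_lebesgue_integral[OF this] assms show ?thesis
    by (simp add: comp_def laplace_shift laplace_shift[of _ _ 0])
qed

text \<open>The quantitative core of the asymptotic independence. With \<open>c1\<close> the upstream and \<open>c2\<close> the downstream
rate, the exponential of the two workloads at time \<open>u + n\<close> is changed in four steps into one whose
factors are independent: the upstream content is dropped from the second exponent, the upstream queue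
is restarted at \<open>u\<close>, the total content at \<open>u + n\<close> is replaced by the sum of its value at \<open>u\<close> and the
content accumulated from \<open>u\<close> on, and this last contribution is dropped. Each step is
dominated by a difference of two ordered exponentials; the expectations of these differences are the
four terms of the bound.\<close>

lemma asymptotic_independence_bound:
  assumes s: "0 \<le> s1" "0 \<le> s2" and c: "c2 \<le> c1"
  shows "\<bar>expectation (\<lambda>\<omega>. exp (- (s1 * queue c1 0 (u + n) \<omega>) - s2 * (queue c2 0 (u + n) \<omega> - queue c1 0 (u + n) \<omega>)))
          - laplace c1 s1 n * laplace c2 s2 u\<bar>
    \<le> (1 - laplace c1 s2 (u + n)) + (laplace c1 s1 n - laplace c1 s1 (u + n))
      + (laplace c2 s2 (u + n) - laplace c2 s2 u * laplace c2 s2 n) + (1 - laplace c2 s2 n)"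
proof -
  define E where "E s x = exp (- (s * x) :: real)" for s x
  define V1 where "V1 = queue c1 0 (u + n)"
  define V2 where "V2 = queue c2 0 (u + n)"
  define q where "q = queue c1 u n"
  define w where "w = queue c2 u n"
  define W where "W = queue c2 0 u"
  have [measurable]: "V1 \<in> borel_measurable M" "V2 \<in> borel_measurable M" "q \<in> borel_measurable M" "w \<in> borel_measurable M" "W \<in> borel_measurable M"
    unfolding V1_def V2_def q_def w_def W_def by auto
  have nn: "0 \<le> V1 \<omega>" "0 \<le> V2 \<omega>" "0 \<le> q \<omega>" "0 \<le> w \<omega>" "0 \<le> W \<omega>" "V1 \<omega> \<le> V2 \<omega>" "q \<omega> \<le> V1 \<omega>" "V2 \<omega> \<le> W \<omega> + w \<omega>" for \<omega>
    unfolding V1_def V2_def q_def w_def W_def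
    using queue_nonneg queue_antimono[OF c] queue_shift_le queue_le_add by auto
  have [measurable]: "E s \<in> borel_measurable borel" for s
    unfolding E_def by measurable
  have mono: "0 \<le> s \<Longrightarrow> x \<le> y \<Longrightarrow> E s y \<le> E s x" for s x y
    by (simp add: E_def mult_left_mono)
  have pos: "0 \<le> E s x" "\<bar>E s x\<bar> = E s x" for s x by (simp_all add: E_def)
  have le1: "0 \<le> s \<Longrightarrow> 0 \<le> x \<Longrightarrow> E s x \<le> 1" for s x by (simp add: E_def)
  have add: "E s (x + y) = E s x * E s y" for s x y
    by (simp add: E_def exp_add[symmetric] algebra_simps)
  have bound: "\<bar>E s1 (V1 \<omega>) * E s2 (V2 \<omega> - V1 \<omega>) - E s1 (q \<omega>) * E s2 (W \<omega>)\<bar>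
      \<le> (1 - E s2 (V1 \<omega>)) + (E s1 (q \<omega>) - E s1 (V1 \<omega>)) + (E s2 (V2 \<omega>) - E s2 (w \<omega>) * E s2 (W \<omega>)) + (1 - E s2 (w \<omega>))" for \<omega>
  proof -
    note nn = nn[of \<omega>]
    have "E s2 (V2 \<omega>) = E s2 (V2 \<omega> - V1 \<omega>) * E s2 (V1 \<omega>)"
      by (simp flip: add)
    then have 1: "E s1 (V1 \<omega>) * E s2 (V2 \<omega> - V1 \<omega>) - E s1 (V1 \<omega>) * E s2 (V2 \<omega>)
        = (E s1 (V1 \<omega>) * E s2 (V2 \<omega> - V1 \<omega>)) * (1 - E s2 (V1 \<omega>))"
      by (simp add: algebra_simps)
    \<comment> \<open>from the downstream content to the total content\<close>
    have 1: "\<bar>E s1 (V1 \<omega>) * E s2 (V2 \<omega> - V1 \<omega>) - E s1 (V1 \<omega>) * E s2 (V2 \<omega>)\<bar> \<le> 1 - E s2 (V1 \<omega>)"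
    proof -
      have "\<bar>(E s1 (V1 \<omega>) * E s2 (V2 \<omega> - V1 \<omega>)) * (1 - E s2 (V1 \<omega>))\<bar> = (E s1 (V1 \<omega>) * E s2 (V2 \<omega> - V1 \<omega>)) * (1 - E s2 (V1 \<omega>))"
        using pos(1)[of s1 "V1 \<omega>"] pos(1)[of s2 "V2 \<omega> - V1 \<omega>"] le1[OF s(2) nn(1)] by (simp add: abs_mult)
      also have "\<dots> \<le> 1 * (1 - E s2 (V1 \<omega>))"
        using le1[OF s(2) nn(1)] le1[OF s(1) nn(1)] le1[OF s(2), of "V2 \<omega> - V1 \<omega>"] nn(6) pos
        by (intro mult_right_mono mult_le_one) auto
      finally show ?thesis by (simp add: 1)
    qed
    \<comment> \<open>the upstream queue forgets what happened before \<open>u\<close>\<close>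
    have 2: "\<bar>E s1 (V1 \<omega>) * E s2 (V2 \<omega>) - E s1 (q \<omega>) * E s2 (V2 \<omega>)\<bar> \<le> E s1 (q \<omega>) - E s1 (V1 \<omega>)"
    proof -
      have "\<bar>E s1 (V1 \<omega>) * E s2 (V2 \<omega>) - E s1 (q \<omega>) * E s2 (V2 \<omega>)\<bar> = (E s1 (q \<omega>) - E s1 (V1 \<omega>)) * E s2 (V2 \<omega>)"
        using mono[OF s(1) nn(7)] pos(1)[of s2 "V2 \<omega>"]
        by (simp add: left_diff_distrib[symmetric] abs_mult)
      also have "\<dots> \<le> (E s1 (q \<omega>) - E s1 (V1 \<omega>)) * 1"
        using mono[OF s(1) nn(7)] le1[OF s(2) nn(2)] by (intro mult_left_mono) auto
      finally show ?thesis by simp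
    qed
    have le: "E s2 (w \<omega>) * E s2 (W \<omega>) \<le> E s2 (V2 \<omega>)"
      using mono[OF s(2) nn(8)] by (simp add: add mult.commute)
    \<comment> \<open>the total content is at most its value at \<open>u\<close> plus that of a queue started at \<open>u\<close>\<close>
    have 3: "\<bar>E s1 (q \<omega>) * E s2 (V2 \<omega>) - E s1 (q \<omega>) * (E s2 (w \<omega>) * E s2 (W \<omega>))\<bar> \<le> E s2 (V2 \<omega>) - E s2 (w \<omega>) * E s2 (W \<omega>)"
    proof -
      have "\<bar>E s1 (q \<omega>) * E s2 (V2 \<omega>) - E s1 (q \<omega>) * (E s2 (w \<omega>) * E s2 (W \<omega>))\<bar> = E s1 (q \<omega>) * (E s2 (V2 \<omega>) - E s2 (w \<omega>) * E s2 (W \<omega>))"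
        using le pos(1)[of s1 "q \<omega>"]
        by (simp add: right_diff_distrib[symmetric] abs_mult)
      also have "\<dots> \<le> 1 * (E s2 (V2 \<omega>) - E s2 (w \<omega>) * E s2 (W \<omega>))"
        using le le1[OF s(1) nn(3)] by (intro mult_right_mono) auto
      finally show ?thesis by simp
    qed
    \<comment> \<open>the content accumulated after \<open>u\<close> is small compared with \<open>1 / s2\<close>\<close>
    have 4: "\<bar>E s1 (q \<omega>) * (E s2 (w \<omega>) * E s2 (W \<omega>)) - E s1 (q \<omega>) * E s2 (W \<omega>)\<bar> \<le> 1 - E s2 (w \<omega>)"
    proof -
      have "\<bar>E s1 (q \<omega>) * (E s2 (w \<omega>) * E s2 (W \<omega>)) - E s1 (q \<omega>) * E s2 (W \<omega>)\<bar> = \<bar>(E s1 (q \<omega>) * E s2 (W \<omega>)) * (E s2 (w \<omega>) - 1)\<bar>"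
        by (simp add: algebra_simps)
      also have "\<dots> = (E s1 (q \<omega>) * E s2 (W \<omega>)) * (1 - E s2 (w \<omega>))"
        using pos(1)[of s1 "q \<omega>"] pos(1)[of s2 "W \<omega>"] le1[OF s(2) nn(4)] by (simp add: abs_mult)
      also have "\<dots> \<le> 1 * (1 - E s2 (w \<omega>))"
        using le1[OF s(2) nn(4)] le1[OF s(1) nn(3)] le1[OF s(2) nn(5)] pos
        by (intro mult_right_mono mult_le_one) auto
      finally show ?thesis by simp
    qed
    from 1 2 3 4 show ?thesis by linarith
  qed
  have int: "integrable M (\<lambda>\<omega>. E s1 (V1 \<omega>) * E s2 (V2 \<omega> - V1 \<omega>))" "integrable M (\<lambda>\<omega>. E s1 (q \<omega>) * E s2 (W \<omega>))"
     "integrable M (\<lambda>\<omega>. E s2 (w \<omega>) * E s2 (W \<omega>))"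
    using s nn pos le1
    by (auto intro!: integrable_const_bound[where B=1] AE_I2 mult_le_one simp: abs_mult)
  have int': "integrable M (\<lambda>\<omega>. E s2 (V1 \<omega>))" "integrable M (\<lambda>\<omega>. E s1 (V1 \<omega>))" "integrable M (\<lambda>\<omega>. E s2 (V2 \<omega>))"
    "integrable M (\<lambda>\<omega>. E s1 (q \<omega>))" "integrable M (\<lambda>\<omega>. E s2 (w \<omega>))"
    using s unfolding E_def V1_def V2_def q_def w_def by auto
  have "\<bar>expectation (\<lambda>\<omega>. E s1 (V1 \<omega>) * E s2 (V2 \<omega> - V1 \<omega>)) - expectation (\<lambda>\<omega>. E s1 (q \<omega>) * E s2 (W \<omega>))\<bar>
     = \<bar>expectation (\<lambda>\<omega>. E s1 (V1 \<omega>) * E s2 (V2 \<omega> - V1 \<omega>) - E s1 (q \<omega>) * E s2 (W \<omega>))\<bar>"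
    using int by simp
  also have "\<dots> \<le> expectation (\<lambda>\<omega>. \<bar>E s1 (V1 \<omega>) * E s2 (V2 \<omega> - V1 \<omega>) - E s1 (q \<omega>) * E s2 (W \<omega>)\<bar>)"
    by (rule integral_abs_bound)
  also have "\<dots> \<le> expectation (\<lambda>\<omega>. (1 - E s2 (V1 \<omega>)) + (E s1 (q \<omega>) - E s1 (V1 \<omega>)) + (E s2 (V2 \<omega>) - E s2 (w \<omega>) * E s2 (W \<omega>)) + (1 - E s2 (w \<omega>)))"
    by (rule integral_mono) (use int int' bound in auto)
  also have "\<dots> = (1 - expectation (\<lambda>\<omega>. E s2 (V1 \<omega>))) + (expectation (\<lambda>\<omega>. E s1 (q \<omega>)) - expectation (\<lambda>\<omega>. E s1 (V1 \<omega>)))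
      + (expectation (\<lambda>\<omega>. E s2 (V2 \<omega>)) - expectation (\<lambda>\<omega>. E s2 (w \<omega>) * E s2 (W \<omega>))) + (1 - expectation (\<lambda>\<omega>. E s2 (w \<omega>)))"
    using int int' by (simp add: prob_space)
  finally have *: "\<bar>expectation (\<lambda>\<omega>. E s1 (V1 \<omega>) * E s2 (V2 \<omega> - V1 \<omega>)) - expectation (\<lambda>\<omega>. E s1 (q \<omega>) * E s2 (W \<omega>))\<bar> \<le> \<dots>" .
  have **: "expectation (\<lambda>\<omega>. E s2 (w \<omega>) * E s2 (W \<omega>)) = laplace c2 s2 u * laplace c2 s2 n"
    "expectation (\<lambda>\<omega>. E s1 (q \<omega>) * E s2 (W \<omega>)) = laplace c1 s1 n * laplace c2 s2 u"
    using laplace_indep[OF s(2) s(2), of c2 u n c2] laplace_indep[OF s, of c1 u n c2]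
    by (auto simp: E_def w_def W_def q_def)
  have ***: "expectation (\<lambda>\<omega>. E s2 (V1 \<omega>)) = laplace c1 s2 (u + n)" "expectation (\<lambda>\<omega>. E s1 (V1 \<omega>)) = laplace c1 s1 (u + n)"
    "expectation (\<lambda>\<omega>. E s2 (V2 \<omega>)) = laplace c2 s2 (u + n)"
    "expectation (\<lambda>\<omega>. E s1 (q \<omega>)) = laplace c1 s1 n" "expectation (\<lambda>\<omega>. E s2 (w \<omega>)) = laplace c2 s2 n"
    unfolding E_def V1_def V2_def q_def w_def laplace_shift by (simp_all add: laplace_def)
  have "exp (- (s1 * V1 \<omega>) - s2 * (V2 \<omega> - V1 \<omega>)) = E s1 (V1 \<omega>) * E s2 (V2 \<omega> - V1 \<omega>)" for \<omega>
    by (simp add: E_def exp_add[symmetric])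
  with * show ?thesis unfolding ** *** by (simp add: V1_def V2_def)
qed

section \<open>The idle-time balance of a reflected random walk\<close>

text \<open>The amount of service that is lost in step \<open>n\<close> because the queue is empty.\<close>

definition idle :: "real \<Rightarrow> nat \<Rightarrow> 'a \<Rightarrow> real" where
  "idle c n \<omega> = max (c - \<eta> n \<omega> - queue c 0 n \<omega>) 0"

lemma integrable_identical:
  assumes [measurable]: "f \<in> borel_measurable borel"
  shows "integrable M (\<lambda>\<omega>. f (\<eta> n \<omega>) :: real) \<longleftrightarrow> integrable M (\<lambda>\<omega>. f (\<eta> 0 \<omega>))"
    and "expectation (\<lambda>\<omega>. f (\<eta> n \<omega>)) = expectation (\<lambda>\<omega>. f (\<eta> 0 \<omega>))"
proof -
  show "integrable M (\<lambda>\<omega>. f (\<eta> n \<omega>) :: real) \<longleftrightarrow> integrable M (\<lambda>\<omega>. f (\<eta> 0 \<omega>))"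
    using integrable_distr_eq[of "\<eta> n" M borel f] integrable_distr_eq[of "\<eta> 0" M borel f]
    by (simp add: identical[of n])
  show "expectation (\<lambda>\<omega>. f (\<eta> n \<omega>)) = expectation (\<lambda>\<omega>. f (\<eta> 0 \<omega>))"
    using integral_distr[of "\<eta> n" M borel f] integral_distr[of "\<eta> 0" M borel f]
    by (simp add: identical[of n])
qed

lemma measurable_idle [measurable]: "random_variable borel (idle c n)"
  unfolding idle_def by measurable

lemma idle_nonneg: "0 \<le> idle c n \<omega>" by (simp add: idle_def)

lemma exp_idle_le:
  assumes "0 \<le> s"
  shows "exp (s * idle c n \<omega>) \<le> 1 + exp (- (s * (\<eta> n \<omega> - c)))"
proof (cases "idle c n \<omega> = 0")
  case False
  then have "idle c n \<omega> \<le> c - \<eta> n \<omega>"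
    using queue_nonneg[of c 0 n \<omega>] by (auto simp: idle_def max_def split: if_splits)
  then have "s * idle c n \<omega> \<le> s * (c - \<eta> n \<omega>)" using assms by (rule mult_left_mono)
  then have "exp (s * idle c n \<omega>) \<le> exp (- (s * (\<eta> n \<omega> - c)))" by (simp add: algebra_simps)
  then show ?thesis by (simp add: add_increasing)
qed simp

context
  fixes c :: real and g :: "real \<Rightarrow> real"
  assumes exp_integrable: "\<And>s. 0 \<le> s \<Longrightarrow> integrable M (\<lambda>\<omega>. exp (- (s * (\<eta> 0 \<omega> - c))))"
  defines "g \<equiv> \<lambda>s. expectation (\<lambda>\<omega>. exp (- (s * (\<eta> 0 \<omega> - c))))"
begin

lemma exp_increment:
  assumes "0 \<le> s"
  shows "integrable M (\<lambda>\<omega>. exp (- (s * (\<eta> n \<omega> - c))))" "expectation (\<lambda>\<omega>. exp (- (s * (\<eta> n \<omega> - c)))) = g s"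
  using exp_integrable[OF assms] integrable_identical[of "\<lambda>x. exp (- (s * (x - c)))" n]
  by (simp_all add: g_def)

lemma integrable_exp_idle: "0 \<le> s \<Longrightarrow> integrable M (\<lambda>\<omega>. exp (s * idle c n \<omega>))"
  by (rule Bochner_Integration.integrable_bound[where f="\<lambda>\<omega>. 1 + exp (- (s * (\<eta> n \<omega> - c)))"])
    (use exp_idle_le[of s _ n] exp_increment(1)[of s n] in \<open>auto simp: add_nonneg_nonneg\<close>)

lemma integrable_idle: "integrable M (idle c n)"
proof (rule Bochner_Integration.integrable_bound[OF integrable_exp_idle[of 1 n]])
  have "x \<le> exp x" for x :: real using exp_ge_add_one_self[of x] by linarith
  then show "AE \<omega> in M. norm (idle c n \<omega>) \<le> norm (exp (1 * idle c n \<omega>))"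
    by (simp add: idle_nonneg)
qed auto

text \<open>From one step of the recursion: the new content \<open>max y 0\<close> satisfies
\<open>exp (- s max y 0) = exp (- s y) - (exp (s max (- y) 0) - 1)\<close>, where \<open>y\<close> is the sum of the old content
and an independent net increment, and the idle amount is \<open>max (- y) 0\<close>.\<close>

lemma exp_idle_balance:
  assumes s: "0 \<le> s"
  shows "expectation (\<lambda>\<omega>. exp (s * idle c n \<omega>) - 1) = laplace c s n * g s - laplace c s (Suc n)"
proof -
  have "indep_var borel ((\<lambda>x. exp (- (s * x))) \<circ> queue c 0 n) borel ((\<lambda>x. exp (- (s * (x - c)))) \<circ> \<eta> n)"
    by (rule indep_var_compose[OF indep_queue_increment]) auto
  note ind = this[unfolded comp_def]
  note prod = indep_var_lebesgue_integral[OF ind integrable_exp_queue[OF s] exp_increment(1)[OF s]]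
    indep_var_integrable[OF ind integrable_exp_queue[OF s] exp_increment(1)[OF s]]
  have "exp (s * idle c n \<omega>) - 1 = exp (- (s * queue c 0 n \<omega>)) * exp (- (s * (\<eta> n \<omega> - c))) - exp (- (s * queue c 0 (Suc n) \<omega>))" for \<omega>
  proof (cases "queue c 0 n \<omega> + \<eta> n \<omega> - c \<ge> 0")
    case True
    then have "idle c n \<omega> = 0" and Q: "queue c 0 (Suc n) \<omega> = queue c 0 n \<omega> + (\<eta> n \<omega> - c)"
      by (auto simp: idle_def queue_def)
    then show ?thesis unfolding Q by (simp add: exp_add[symmetric] algebra_simps)
  next
    case False
    then have I: "idle c n \<omega> = c - \<eta> n \<omega> - queue c 0 n \<omega>" and "queue c 0 (Suc n) \<omega> = 0"
      by (auto simp: idle_def queue_def)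
    then show ?thesis unfolding I by (simp add: exp_add[symmetric] algebra_simps)
  qed
  then show ?thesis
    using prod integrable_exp_queue[OF s, of c 0 "Suc n"]
    by (simp add: exp_increment(2)[OF s] laplace_def)
qed

text \<open>As for the transforms, but in the other direction: a longer history means more content and
therefore less idling.\<close>

lemma decseq_idle: "decseq (\<lambda>n. expectation (idle c n))"
proof (rule decseq_SucI)
  fix n
  have meas: "(\<lambda>x. max (c - x n - reflect (\<lambda>k. x k - c) n) 0) \<in> borel_measurable (PiM {..<Suc n} (\<lambda>_. borel))"
  proof -
    have [measurable]: "(\<lambda>x. reflect (\<lambda>k. x k - c) n) \<in> borel_measurable (PiM {..<Suc n} (\<lambda>_. borel))"
      using measurable_reflect_PiM[of 0 n "{..<Suc n}" c] by (simp add: lessThan_atLeast0)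
    show ?thesis by measurable
  qed
  have cong: "reflect (\<lambda>k. (\<lambda>k\<in>{..<Suc n}. \<eta> (v + k) \<omega>) k - c) n = queue c v n \<omega>" for v \<omega>
    unfolding queue_def by (rule reflect_cong) simp
  define z where "z v \<omega> = max (c - \<eta> (v + n) \<omega> - queue c v n \<omega>) 0" for v \<omega>
  have z: "expectation (z 1) = expectation (idle c n)"
    using expectation_shift[OF meas, of 1] cong[of 1] cong[of 0] by (simp add: z_def[abs_def] idle_def[abs_def])
  have "expectation (idle c (Suc n)) \<le> expectation (z 1)"
  proof (rule integral_mono')
    have "idle c (Suc n) \<omega> \<le> z 1 \<omega>" for \<omega>
      using queue_shift_le[of c 1 n \<omega>] by (auto simp: z_def idle_def)
    then show "\<And>\<omega>. idle c (Suc n) \<omega> \<le> z 1 \<omega>" .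
    show "integrable M (z 1)"
    proof (rule Bochner_Integration.integrable_bound[where f="\<lambda>\<omega>. exp (- (1 * (\<eta> (1 + n) \<omega> - c)))"])
      have e: "x \<le> exp x" for x :: real using exp_ge_add_one_self[of x] by linarith
      have "z 1 \<omega> \<le> exp (- (1 * (\<eta> (1 + n) \<omega> - c)))" for \<omega>
        using e[of "c - \<eta> (1 + n) \<omega>"] queue_nonneg[of c 1 n \<omega>]
        unfolding z_def by (simp add: max_def)
      moreover have "0 \<le> z 1 \<omega>" for \<omega> by (simp add: z_def)
      ultimately have "norm (z 1 \<omega>) \<le> norm (exp (- (1 * (\<eta> (1 + n) \<omega> - c))))" for \<omega> by simp
      then show "AE \<omega> in M. norm (z 1 \<omega>) \<le> norm (exp (- (1 * (\<eta> (1 + n) \<omega> - c))))" by simp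
    qed (use exp_increment(1)[of 1] in \<open>auto simp: z_def[abs_def]\<close>)
    show "\<And>\<omega>. 0 \<le> z 1 \<omega>" by (simp add: z_def)
  qed
  then show "expectation (idle c (Suc n)) \<le> expectation (idle c n)" by (simp only: z)
qed

lemma exp_idle_lower:
  assumes s: "0 \<le> s"
  shows "s * expectation (idle c n) \<le> laplace c s n * g s - laplace c s (Suc n)"
proof -
  have "expectation (\<lambda>\<omega>. s * idle c n \<omega>) \<le> expectation (\<lambda>\<omega>. exp (s * idle c n \<omega>) - 1)"
  proof (rule integral_mono)
    show "s * idle c n \<omega> \<le> exp (s * idle c n \<omega>) - 1" for \<omega>
      using exp_ge_add_one_self[of "s * idle c n \<omega>"] by linarith
  qed (use integrable_idle integrable_exp_idle[OF s] in auto)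
  then show ?thesis by (simp add: exp_idle_balance[OF s])
qed

text \<open>The free parameter \<open>l\<close> is the inverse of the length scale on which the idle amount lives: a square is
traded for an exponential by \<open>(l z)\<^sup>2 / 2 \<le> exp (l z)\<close>. For mesh \<open>h\<close> the right choice is \<open>h\<close> to the
power \<open>- 1 / \<alpha>\<close>.\<close>

lemma exp_idle_upper:
  assumes s: "0 \<le> s" and l: "0 < l"
  shows "laplace c s n * g s - laplace c s (Suc n) \<le> s * expectation (idle c n) + s\<^sup>2 / l\<^sup>2 * (1 + g (l + s))"
proof -
  have "expectation (\<lambda>\<omega>. exp (s * idle c n \<omega>) - 1)
      \<le> expectation (\<lambda>\<omega>. s * idle c n \<omega> + s\<^sup>2 / l\<^sup>2 * (1 + exp (- ((l + s) * (\<eta> n \<omega> - c)))))"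
  proof (rule integral_mono)
    fix \<omega>
    define z where "z = idle c n \<omega>"
    have z: "0 \<le> z" by (simp add: z_def idle_nonneg)
    have "(l * z)\<^sup>2 / 2 \<le> exp (l * z)"
    proof -
      have "0 \<le> l * z" using l z by simp
      from exp_lower_Taylor_quadratic[OF this] this show ?thesis by linarith
    qed
    have "exp (s * z) - 1 - s * z \<le> (s * z)\<^sup>2 / 2 * exp (s * z)"
      using s z by (intro exp_second_order) simp
    also have "\<dots> = s\<^sup>2 / l\<^sup>2 * ((l * z)\<^sup>2 / 2 * exp (s * z))"
      using l by (simp add: power_mult_distrib)
    also have "\<dots> \<le> s\<^sup>2 / l\<^sup>2 * (exp (l * z) * exp (s * z))"
      using \<open>(l * z)\<^sup>2 / 2 \<le> exp (l * z)\<close> by (intro mult_left_mono mult_right_mono) auto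
    also have "exp (l * z) * exp (s * z) = exp ((l + s) * z)"
      by (simp add: exp_add[symmetric] algebra_simps)
    also have "s\<^sup>2 / l\<^sup>2 * exp ((l + s) * z) \<le> s\<^sup>2 / l\<^sup>2 * (1 + exp (- ((l + s) * (\<eta> n \<omega> - c))))"
      unfolding z_def using s l by (intro mult_left_mono exp_idle_le) auto
    finally show "exp (s * idle c n \<omega>) - 1 \<le> s * idle c n \<omega> + s\<^sup>2 / l\<^sup>2 * (1 + exp (- ((l + s) * (\<eta> n \<omega> - c))))"
      by (simp add: z_def)
  next
    show "integrable M (\<lambda>\<omega>. s * idle c n \<omega> + s\<^sup>2 / l\<^sup>2 * (1 + exp (- ((l + s) * (\<eta> n \<omega> - c)))))"
      using s l by (intro Bochner_Integration.integrable_add integrable_mult_right integrable_idle exp_increment(1)) auto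
  qed (use integrable_exp_idle[OF s] in auto)
  also have "\<dots> = s * expectation (idle c n) + s\<^sup>2 / l\<^sup>2 * (1 + g (l + s))"
    using integrable_idle[of n] exp_increment[of "l + s" n] s l
    by (simp add: prob_space)
  finally show ?thesis
    by (simp add: exp_idle_balance[OF s])
qed

text \<open>The long-run form of the balance. The constant \<open>b\<close> is the limiting mean idle amount per step; what
matters is that one \<open>b\<close> serves for all \<open>s\<close>.\<close>

lemma idle_limit:
  obtains b where "\<And>s. 0 \<le> s \<Longrightarrow> s * b \<le> lim (laplace c s) * (g s - 1)"
    and "\<And>s l. 0 \<le> s \<Longrightarrow> 0 < l \<Longrightarrow> lim (laplace c s) * (g s - 1) \<le> s * b + s\<^sup>2 / l\<^sup>2 * (1 + g (l + s))"
proof -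
  have "convergent (\<lambda>n. expectation (idle c n))"
    using decseq_idle by (rule decseq_convergent[of _ 0]) (auto simp: idle_nonneg convergent_def)
  then obtain b where b: "(\<lambda>n. expectation (idle c n)) \<longlonglongrightarrow> b" by (auto simp: convergent_def)
  have a: "laplace c s \<longlonglongrightarrow> lim (laplace c s)" if "0 \<le> s" for s
    using decseq_convergent[OF decseq_laplace[OF that], of 0] laplace_nonneg
    by (metis limI)
  have d: "(\<lambda>n. laplace c s n * g s - laplace c s (Suc n)) \<longlonglongrightarrow> lim (laplace c s) * (g s - 1)" if "0 \<le> s" for s
    using tendsto_diff[OF tendsto_mult_right[OF a[OF that], of "g s"] LIMSEQ_Suc[OF a[OF that]]]
    by (simp add: algebra_simps)
  show ?thesis
  proof (rule that[of b])
    fix s :: real assume s: "0 \<le> s"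
    show "s * b \<le> lim (laplace c s) * (g s - 1)"
      by (rule LIMSEQ_le[OF tendsto_mult_left[OF b] d[OF s]]) (use exp_idle_lower[OF s] in auto)
    fix l :: real assume l: "0 < l"
    show "lim (laplace c s) * (g s - 1) \<le> s * b + s\<^sup>2 / l\<^sup>2 * (1 + g (l + s))"
      by (rule LIMSEQ_le[OF d[OF s] tendsto_add[OF tendsto_mult_left[OF b] tendsto_const]]) (use exp_idle_upper[OF s l] in auto)
  qed
qed

end
end

section \<open>Levy processes on dyadic grids\<close>

text \<open>Without this bound an infimum of the path would be an unspecified real number.\<close>

lemma cadlag_bdd_below:
  fixes f :: "real \<Rightarrow> real"
  assumes right: "\<And>t. 0 \<le> t \<Longrightarrow> continuous (at_right t) f"
    and left: "\<And>t. 0 < t \<Longrightarrow> \<exists>l. (f \<longlongrightarrow> l) (at_left t)"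
    and T: "0 \<le> T"
  shows "bdd_below (f ` {0..T})"
proof -
  have "bdd_below (f ` ({0..T} \<inter> {0..}))"
    using T
  proof (induction rule: Bolzano[where P="\<lambda>a b. bdd_below (f ` ({a..b} \<inter> {0..}))"])
    case (trans a b c)
    then have "{a..c} = {a..b} \<union> {b..c}" by auto
    with trans show ?case by (simp add: Int_Un_distrib2 image_Un)
  next
    case (local x)
    have "eventually (\<lambda>y. f x - 1 < f y) (at_right x)"
      using right[OF local(1)] unfolding continuous_within by (rule order_tendstoD) simp
    then obtain u where u: "x < u" "\<And>y. x < y \<Longrightarrow> y < u \<Longrightarrow> f x - 1 < f y"
      unfolding eventually_at_right_field by blast
    obtain v m where v: "v < x" "\<And>y. v < y \<Longrightarrow> y < x \<Longrightarrow> 0 \<le> y \<Longrightarrow> m < f y"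
    proof (cases "x = 0")
      case True
      then show ?thesis using that[of "-1"] by auto
    next
      case False
      then obtain l where l: "(f \<longlongrightarrow> l) (at_left x)" using left[of x] local(1) by auto
      have "eventually (\<lambda>y. l - 1 < f y) (at_left x)"
        using l by (rule order_tendstoD) simp
      then show ?thesis using that[of _ "l - 1"] unfolding eventually_at_left_field by blast
    qed
    show ?case
    proof (intro exI[of _ "min (u - x) (x - v)"] conjI allI impI)
      show "0 < min (u - x) (x - v)" using u v by simp
      fix a b assume ab: "a \<le> x \<and> x \<le> b \<and> b - a < min (u - x) (x - v)"
      show "bdd_below (f ` ({a..b} \<inter> {0..}))"
      proof (rule bdd_belowI2)
        fix y assume y: "y \<in> {a..b} \<inter> {0..}"
        consider "y < x" | "y = x" | "x < y" by linarith
        then show "min (f x - 1) m \<le> f y"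
        proof cases
          case 1
          then have "m < f y" using y ab by (intro v(2)) auto
          then show ?thesis by simp
        next
          case 3
          then have "f x - 1 < f y" using y ab by (intro u(2)) auto
          then show ?thesis by simp
        qed auto
      qed
    qed
  qed
  then show ?thesis by (simp add: Int_absorb2)
qed

text \<open>Right-continuity suffices because a time \<open>s\<close> is approached from the right by the grid points
\<open>\<lceil>s * 2 ^ j\<rceil> / 2 ^ j\<close>. The end point \<open>T\<close> is an integer, so these points stay in the interval.\<close>

lemma dyadic_Min_tendsto_INF:
  fixes f :: "real \<Rightarrow> real" and T :: nat
  assumes right: "\<And>t. 0 \<le> t \<Longrightarrow> continuous (at_right t) f"
    and bdd: "bdd_below (f ` {0..real T})"
  shows "(\<lambda>j. Min ((\<lambda>i. f (real i / 2 ^ j)) ` {..T * 2 ^ j})) \<longlonglongrightarrow> (INF s\<in>{0..real T}. f s)"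
proof (rule order_tendstoI)
  define m where "m j = Min ((\<lambda>i. f (real i / 2 ^ j)) ` {..T * 2 ^ j})" for j :: nat
  have grid: "real i / 2 ^ j \<in> {0..real T}" if "i \<le> T * 2 ^ j" for i j :: nat
  proof -
    have "real i \<le> real T * 2 ^ j" using that by (metis of_nat_le_iff of_nat_mult of_nat_numeral of_nat_power)
    then show ?thesis by (simp add: divide_le_eq)
  qed
  have "(INF s\<in>{0..real T}. f s) \<le> m j" for j
    unfolding m_def by (rule Min.boundedI) (auto intro!: cINF_lower[OF bdd] dest!: grid simp del: atLeastAtMost_iff)
  then show "\<forall>\<^sub>F j in sequentially. a < Min ((\<lambda>i. f (real i / 2 ^ j)) ` {..T * 2 ^ j})" if "a < (INF s\<in>{0..real T}. f s)" for a
    using that by (auto simp: m_def intro!: always_eventually less_le_trans[OF that])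
  fix a assume "(INF s\<in>{0..real T}. f s) < a"
  then obtain s where s: "s \<in> {0..real T}" "f s < a"
    using bdd by (subst (asm) cINF_less_iff) auto
  have "eventually (\<lambda>y. f y < a) (at_right s)"
    using right[of s] s unfolding continuous_within by (intro order_tendstoD(2)[of f "f s"]) auto
  then obtain u where u: "s < u" "\<And>y. s < y \<Longrightarrow> y < u \<Longrightarrow> f y < a"
    unfolding eventually_at_right_field by blast
  have "(\<lambda>j. (1/2) ^ j :: real) \<longlonglongrightarrow> 0" by (rule LIMSEQ_power_zero) simp
  then have "\<forall>\<^sub>F j in sequentially. (1/2) ^ j < u - s"
    using u(1) by (intro order_tendstoD(2)[of _ 0]) auto
  then show "\<forall>\<^sub>F j in sequentially. Min ((\<lambda>i. f (real i / 2 ^ j)) ` {..T * 2 ^ j}) < a"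
  proof eventually_elim
    case (elim j)
    define i where "i = nat \<lceil>s * 2 ^ j\<rceil>"
    have s0: "0 \<le> s * 2 ^ j" using s by simp
    have i1: "s * 2 ^ j \<le> real i" "real i < s * 2 ^ j + 1"
      unfolding i_def using s0 by linarith+
    have "s * 2 ^ j \<le> real (T * 2 ^ j)" using s by simp
    then have i2: "i \<le> T * 2 ^ j" unfolding i_def by (simp add: nat_le_iff ceiling_le_iff)
    have 3: "s \<le> real i / 2 ^ j" using i1(1) by (simp add: le_divide_eq)
    have "real i / 2 ^ j < s + (1/2) ^ j"
      using i1(2) by (simp add: divide_less_eq distrib_right power_one_over)
    then have 4: "real i / 2 ^ j < u" using elim by linarith
    have "f (real i / 2 ^ j) < a"
      using u(2)[OF _ 4] s(2) 3 by (cases "s = real i / 2 ^ j") auto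
    moreover have "Min ((\<lambda>i. f (real i / 2 ^ j)) ` {..T * 2 ^ j}) \<le> f (real i / 2 ^ j)"
      using i2 by (intro Min_le) auto
    ultimately show ?case by linarith
  qed
qed

lemma (in prob_space) indep_vars_UNIV_nat:
  fixes X :: "nat \<Rightarrow> 'a \<Rightarrow> 'b"
  assumes "\<And>n. indep_vars M' X {..<n}"
  shows "indep_vars M' X UNIV"
  unfolding indep_vars_def2
proof (intro conjI ballI)
  fix i show "random_variable (M' i) (X i)"
    using assms[of "Suc i"] unfolding indep_vars_def2 by auto
  show "indep_sets (\<lambda>i. {X i -` A \<inter> space M |A. A \<in> sets (M' i)}) UNIV"
  proof (subst indep_sets_finite_index_sets, intro allI impI)
    fix I :: "nat set" assume "finite I"
    then obtain n where "I \<subseteq> {..<n}" using finite_nat_iff_bounded by auto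
    then show "indep_sets (\<lambda>i. {X i -` A \<inter> space M |A. A \<in> sets (M' i)}) I"
      using assms[of n] unfolding indep_vars_def2 by (blast intro: indep_sets_mono_index)
  qed
qed

context levy_process
begin

definition increment :: "nat \<Rightarrow> nat \<Rightarrow> 'a \<Rightarrow> real" where
  "increment j k \<omega> = J (real (Suc k) / 2 ^ j) \<omega> - J (real k / 2 ^ j) \<omega>"

lemma iid_increment: "iid_sequence M (increment j)"
proof
  show "indep_vars (\<lambda>_. borel) (increment j) UNIV"
  proof (rule indep_vars_UNIV_nat)
    show "indep_vars (\<lambda>_. borel) (increment j) {..<n}" for n
      using independent_increments[of "\<lambda>i. real i / 2 ^ j" n]
      by (simp add: increment_def[abs_def] divide_right_mono)
  qed
  show "distr M borel (increment j k) = distr M borel (increment j 0)" for k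
  proof -
    have "distr M borel (increment j k) = distr M borel (J (1 / 2 ^ j))" for k
      using stationary_increments[of "real k / 2 ^ j" "real (Suc k) / 2 ^ j"]
      by (simp add: increment_def[abs_def] divide_right_mono diff_divide_distrib[symmetric])
    from this[of k] this[of 0] show ?thesis by simp
  qed
qed

abbreviation "queue j \<equiv> iid_sequence.queue (increment j)"
abbreviation "laplace j \<equiv> iid_sequence.laplace M (increment j)"

text \<open>Only integer times occur: they belong to every dyadic grid, and they are enough to identify limits as
time tends to infinity.\<close>

definition workload_transform :: "real \<Rightarrow> real \<Rightarrow> nat \<Rightarrow> real" where
  "workload_transform c s T = expectation (\<lambda>\<omega>. exp (- (s * upstream_workload J c (real T) \<omega>)))"

lemma path_bdd_below:
  assumes "\<omega> \<in> space M" "0 \<le> T"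
  shows "bdd_below ((\<lambda>s. net_input J c s \<omega>) ` {0..T})"
proof (rule cadlag_bdd_below[OF _ _ assms(2)])
  show "continuous (at_right t) (\<lambda>s. net_input J c s \<omega>)" if "0 \<le> t" for t
    unfolding net_input_def using right_continuous[OF assms(1) that] by (intro continuous_intros)
  fix t :: real assume "0 < t"
  then obtain l where "((\<lambda>s. J s \<omega>) \<longlongrightarrow> l) (at_left t)" using left_limits[OF assms(1)] by blast
  then have "((\<lambda>s. J s \<omega> - c * s) \<longlongrightarrow> l - c * t) (at_left t)" by (intro tendsto_intros)
  then show "\<exists>l. ((\<lambda>s. net_input J c s \<omega>) \<longlongrightarrow> l) (at_left t)" unfolding net_input_def by blast
qed

lemma queue_eq_Min:
  "queue j (c / 2 ^ j) 0 n \<omega> = net_input J c (real n / 2 ^ j) \<omega> - Min ((\<lambda>i. net_input J c (real i / 2 ^ j) \<omega>) ` {..n})"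
proof -
  have "(\<lambda>k. increment j (0 + k) \<omega> - c / 2 ^ j) = (\<lambda>k. net_input J c (real (Suc k) / 2 ^ j) \<omega> - net_input J c (real k / 2 ^ j) \<omega>)"
    by (simp add: fun_eq_iff increment_def net_input_def field_simps)
  then show ?thesis
    unfolding iid_sequence.queue_def[OF iid_increment]
    using reflect_increments[of "\<lambda>k. net_input J c (real k / 2 ^ j) \<omega>" n] by simp
qed

lemma queue_tendsto:
  assumes "\<omega> \<in> space M"
  shows "(\<lambda>j. queue j (c / 2 ^ j) 0 (T * 2 ^ j) \<omega>) \<longlonglongrightarrow> upstream_workload J c (real T) \<omega>"
proof -
  have "(\<lambda>j. net_input J c (real T) \<omega> - Min ((\<lambda>i. net_input J c (real i / 2 ^ j) \<omega>) ` {..T * 2 ^ j}))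
      \<longlonglongrightarrow> net_input J c (real T) \<omega> - (INF s\<in>{0..real T}. net_input J c s \<omega>)"
  proof (intro tendsto_diff tendsto_const dyadic_Min_tendsto_INF path_bdd_below assms)
    show "continuous (at_right t) (\<lambda>s. net_input J c s \<omega>)" if "0 \<le> t" for t
      unfolding net_input_def using right_continuous[OF assms that] by (intro continuous_intros)
  qed simp
  then show ?thesis by (simp add: queue_eq_Min upstream_workload_def regulator_def)
qed

lemma upstream_nonneg:
  assumes "\<omega> \<in> space M" shows "0 \<le> upstream_workload J c (real T) \<omega>"
  by (rule LIMSEQ_le_const[OF queue_tendsto[OF assms]])
    (auto simp: iid_sequence.queue_nonneg[OF iid_increment])

lemma queue_le_upstream:
  assumes "\<omega> \<in> space M"
  shows "queue j (c / 2 ^ j) 0 (T * 2 ^ j) \<omega> \<le> upstream_workload J c (real T) \<omega>"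
proof -
  have "(INF s\<in>{0..real T}. net_input J c s \<omega>) \<le> Min ((\<lambda>i. net_input J c (real i / 2 ^ j) \<omega>) ` {..T * 2 ^ j})"
  proof (rule Min.boundedI)
    fix y assume "y \<in> (\<lambda>i. net_input J c (real i / 2 ^ j) \<omega>) ` {..T * 2 ^ j}"
    then obtain i where i: "i \<le> T * 2 ^ j" and y: "y = net_input J c (real i / 2 ^ j) \<omega>" by auto
    have "real i \<le> real T * 2 ^ j" using i by (metis of_nat_le_iff of_nat_mult of_nat_numeral of_nat_power)
    then show "(INF s\<in>{0..real T}. net_input J c s \<omega>) \<le> y"
      unfolding y by (intro cINF_lower path_bdd_below assms) (auto simp: divide_le_eq)
  qed auto
  then show ?thesis by (simp add: queue_eq_Min upstream_workload_def regulator_def)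
qed

lemma measurable_queue [measurable]: "random_variable borel (queue j c u n)"
  by (rule iid_sequence.measurable_queue[OF iid_increment])

lemma measurable_upstream [measurable]: "random_variable borel (upstream_workload J c (real T))"
  by (rule borel_measurable_LIMSEQ_real[OF queue_tendsto]) auto

lemma integrable_exp_upstream: "0 \<le> s \<Longrightarrow> integrable M (\<lambda>\<omega>. exp (- (s * upstream_workload J c (real T) \<omega>)))"
  by (rule integrable_const_bound[where B=1]) (auto intro!: AE_I2 simp: upstream_nonneg)

lemma workload_transform_bounds:
  assumes "0 \<le> s" shows "0 \<le> workload_transform c s T" "workload_transform c s T \<le> 1"
proof -
  show "0 \<le> workload_transform c s T" unfolding workload_transform_def by simp
  have "workload_transform c s T \<le> expectation (\<lambda>\<omega>. 1)"
    unfolding workload_transform_def by (rule integral_mono) (use assms integrable_exp_upstream in \<open>auto simp: upstream_nonneg\<close>)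
  then show "workload_transform c s T \<le> 1" by (simp add: prob_space)
qed

lemma laplace_tendsto:
  assumes "0 \<le> s"
  shows "(\<lambda>j. laplace j (c / 2 ^ j) s (T * 2 ^ j)) \<longlonglongrightarrow> workload_transform c s T"
  unfolding iid_sequence.laplace_def[OF iid_increment] workload_transform_def
proof (rule integral_dominated_convergence[where w="\<lambda>_. 1"])
  show "AE \<omega> in M. (\<lambda>j. exp (- (s * queue j (c / 2 ^ j) 0 (T * 2 ^ j) \<omega>))) \<longlonglongrightarrow> exp (- (s * upstream_workload J c (real T) \<omega>))"
    by (intro AE_I2 tendsto_intros queue_tendsto)
qed (use assms in \<open>auto intro!: AE_I2 simp: iid_sequence.queue_nonneg[OF iid_increment]\<close>)

lemma workload_transform_le_laplace:
  assumes "0 \<le> s" shows "workload_transform c s T \<le> laplace j (c / 2 ^ j) s (T * 2 ^ j)"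
  unfolding iid_sequence.laplace_def[OF iid_increment] workload_transform_def
  by (rule integral_mono)
    (use assms queue_le_upstream in \<open>auto intro!: integrable_exp_upstream iid_sequence.integrable_exp_queue[OF iid_increment] mult_left_mono\<close>)

text \<open>The two limits, of time to infinity and of mesh to zero, may be exchanged because the transform of
the grid queue decreases in time and always lies above that of the continuous-time workload.\<close>

lemma lim_laplace_tendsto:
  assumes s: "0 \<le> s" and A: "workload_transform c s \<longlonglongrightarrow> A"
  shows "(\<lambda>j. lim (laplace j (c / 2 ^ j) s)) \<longlonglongrightarrow> A"
proof -
  define L where "L j = lim (laplace j (c / 2 ^ j) s)" for j
  have conv: "laplace j (c / 2 ^ j) s \<longlonglongrightarrow> L j" for j
    unfolding L_def
    using decseq_convergent[OF iid_sequence.decseq_laplace[OF iid_increment s], of 0]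
      iid_sequence.laplace_nonneg[OF iid_increment] by (metis limI)
  have upper: "L j \<le> laplace j (c / 2 ^ j) s n" for j n
    using decseq_ge[OF iid_sequence.decseq_laplace[OF iid_increment s] conv] .
  have lower: "A \<le> L j" for j
  proof (rule LIMSEQ_le[OF A])
    show "(\<lambda>T. laplace j (c / 2 ^ j) s (T * 2 ^ j)) \<longlonglongrightarrow> L j"
      by (rule filterlim_compose[OF conv]) (auto intro!: filterlim_subseq simp: strict_mono_def)
  qed (use workload_transform_le_laplace[OF s] in auto)
  have "L \<longlonglongrightarrow> A"
  proof (rule order_tendstoI)
    show "\<forall>\<^sub>F j in sequentially. a < L j" if "a < A" for a
      using that lower by (auto intro!: always_eventually less_le_trans[OF that])
    fix a assume "A < a"
    then have "\<forall>\<^sub>F T in sequentially. workload_transform c s T < a" by (rule order_tendstoD(2)[OF A])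
    then obtain T where "workload_transform c s T < a" by (auto simp: eventually_sequentially)
    then have "\<forall>\<^sub>F j in sequentially. laplace j (c / 2 ^ j) s (T * 2 ^ j) < a"
      by (rule order_tendstoD(2)[OF laplace_tendsto[OF s]])
    then show "\<forall>\<^sub>F j in sequentially. L j < a"
      by eventually_elim (use upper in \<open>auto intro: le_less_trans\<close>)
  qed
  then show ?thesis by (simp add: L_def[abs_def])
qed

text \<open>The exponential of \<open>J 1\<close> is the product of \<open>2 ^ j\<close> independent copies of the one for an increment.
The argument uses nonnegative integrals, so that the finiteness of the moment of the increment is a
conclusion.\<close>

lemma increment_exp_moment:
  assumes int: "integrable M (\<lambda>\<omega>. exp (- (s * J 1 \<omega>)))" and K: "expectation (\<lambda>\<omega>. exp (- (s * J 1 \<omega>))) = exp K"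
  shows "integrable M (\<lambda>\<omega>. exp (- (s * increment j 0 \<omega>)))"
    and "expectation (\<lambda>\<omega>. exp (- (s * increment j 0 \<omega>))) = exp (K / 2 ^ j)"
proof -
  interpret I: iid_sequence M "increment j" by (rule iid_increment)
  define X where "X k \<omega> = exp (- (s * increment j k \<omega>))" for k \<omega>
  have [measurable]: "X k \<in> borel_measurable M" for k unfolding X_def by measurable
  have X_nonneg: "0 \<le> X k \<omega>" for k \<omega> by (simp add: X_def)
  have prod: "(\<Prod>k<2 ^ j. X k \<omega>) = exp (- (s * J 1 \<omega>))" if "\<omega> \<in> space M" for \<omega>
  proof -
    have "(\<Sum>k<2 ^ j. increment j k \<omega>) = J 1 \<omega>"
      using sum_lessThan_telescope[of "\<lambda>k. J (real k / 2 ^ j) \<omega>" "2 ^ j"] start_zero[OF that]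
      by (simp add: increment_def)
    then have "exp (- (s * J 1 \<omega>)) = exp (\<Sum>k<2 ^ j. - (s * increment j k \<omega>))"
      by (simp add: sum_distrib_left[symmetric] sum_negf)
    also have "\<dots> = (\<Prod>k<2 ^ j. X k \<omega>)" by (simp add: exp_sum X_def)
    finally show ?thesis by simp
  qed
  have "indep_vars (\<lambda>_. borel) (\<lambda>k \<omega>. ennreal (exp (- (s * increment j k \<omega>)))) UNIV"
    by (rule indep_vars_compose2[OF I.independent, where Y="\<lambda>_ x. ennreal (exp (- (s * x)))"]) auto
  then have "indep_vars (\<lambda>_. borel) (\<lambda>k \<omega>. ennreal (X k \<omega>)) {..<2 ^ j}"
    unfolding X_def by (rule indep_vars_subset) simp
  then have 1: "(\<integral>\<^sup>+\<omega>. (\<Prod>k<2 ^ j. ennreal (X k \<omega>)) \<partial>M) = (\<Prod>k<2 ^ j. \<integral>\<^sup>+\<omega>. ennreal (X k \<omega>) \<partial>M)"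
    by (intro indep_vars_nn_integral) auto
  have 2: "(\<integral>\<^sup>+\<omega>. ennreal (X k \<omega>) \<partial>M) = (\<integral>\<^sup>+\<omega>. ennreal (X 0 \<omega>) \<partial>M)" for k
  proof -
    have "(\<integral>\<^sup>+\<omega>. ennreal (X k \<omega>) \<partial>M) = (\<integral>\<^sup>+x. ennreal (exp (- (s * x))) \<partial>distr M borel (increment j k))" for k
      unfolding X_def by (subst nn_integral_distr) auto
    from this[of k] this[of 0] show ?thesis by (simp add: I.identical[of k])
  qed
  have 3: "(\<Prod>k<2 ^ j. \<integral>\<^sup>+\<omega>. ennreal (X k \<omega>) \<partial>M) = (\<Prod>k<(2::nat) ^ j. \<integral>\<^sup>+\<omega>. ennreal (X 0 \<omega>) \<partial>M)"
    by (rule prod.cong[OF refl 2])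
  have "(\<integral>\<^sup>+\<omega>. (\<Prod>k<2 ^ j. ennreal (X k \<omega>)) \<partial>M) = (\<integral>\<^sup>+\<omega>. ennreal (exp (- (s * J 1 \<omega>))) \<partial>M)"
    by (rule nn_integral_cong) (simp add: prod_ennreal X_nonneg prod)
  also have "\<dots> = ennreal (exp K)"
    using nn_integral_eq_integral[OF int] K by simp
  finally have pow: "ennreal (exp K) = (\<integral>\<^sup>+\<omega>. ennreal (X 0 \<omega>) \<partial>M) ^ (2 ^ j)"
    using 1 3 by simp
  have "(\<integral>\<^sup>+\<omega>. ennreal (X 0 \<omega>) \<partial>M) \<noteq> \<infinity>"
  proof
    assume "(\<integral>\<^sup>+\<omega>. ennreal (X 0 \<omega>) \<partial>M) = \<infinity>"
    with pow show False by simp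
  qed
  then have int0: "integrable M (X 0)"
    by (intro integrableI_nonneg) (auto simp: X_def less_top)
  then show "integrable M (\<lambda>\<omega>. exp (- (s * increment j 0 \<omega>)))" by (simp add: X_def[abs_def])
  have "(\<integral>\<^sup>+\<omega>. ennreal (X 0 \<omega>) \<partial>M) = ennreal (expectation (X 0))"
    by (rule nn_integral_eq_integral[OF int0]) (simp add: X_def)
  then have "ennreal (exp K) = ennreal (expectation (X 0) ^ (2 ^ j))"
    using pow by (simp add: ennreal_power X_def)
  then have "expectation (X 0) ^ (2 ^ j) = exp K"
    by (subst (asm) ennreal_inj) (auto simp: X_def)
  also have "\<dots> = exp (K / 2 ^ j) ^ (2 ^ j)"
    by (simp flip: exp_of_nat_mult)
  finally have "expectation (X 0) = exp (K / 2 ^ j)"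
    by (rule power_eq_imp_eq_base) (auto simp: X_def)
  then show "expectation (\<lambda>\<omega>. exp (- (s * increment j 0 \<omega>))) = exp (K / 2 ^ j)"
    by (simp add: X_def[abs_def])
qed

section \<open>The Pollaczek-Khinchine formula for stable input\<close>

text \<open>As the mesh goes to zero, the idle-time balance determines the limit transform up to the idle rate, which
is the same for all \<open>s\<close>. The assumption \<open>A0\<close>, which says that the limit law of the workload has no
mass at infinity, then fixes the idle rate to be \<open>r\<close>.\<close>

lemma stable_pollaczek_khinchine:
  fixes A :: "real \<Rightarrow> real"
  assumes \<alpha>: "1 < \<alpha>" "\<alpha> < 2" and C: "0 < C" and r: "0 < r"
    and int: "\<And>s. 0 \<le> s \<Longrightarrow> integrable M (\<lambda>\<omega>. exp (- (s * J 1 \<omega>)))"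
    and J: "\<And>s. 0 \<le> s \<Longrightarrow> expectation (\<lambda>\<omega>. exp (- (s * J 1 \<omega>))) = exp (C * s powr \<alpha> - s * m)"
    and A: "\<And>s. 0 < s \<Longrightarrow> workload_transform (m + r) s \<longlonglongrightarrow> A s" and A0: "(A \<longlongrightarrow> 1) (at_right 0)"
    and s: "0 < s"
  shows "A s = 1 / (1 + C / r * s powr (\<alpha> - 1))"
proof -
  define c where "c = m + r"
  define \<phi> where "\<phi> s = r * s + C * s powr \<alpha>" for s
  define L where "L j s = lim (laplace j (c / 2 ^ j) s)" for j s
  define g where "g j s = exp (\<phi> s / 2 ^ j)" for j :: nat and s
  have int_j: "integrable M (\<lambda>\<omega>. exp (- (s * (increment j 0 \<omega> - c / 2 ^ j))))"
    and g_j: "expectation (\<lambda>\<omega>. exp (- (s * (increment j 0 \<omega> - c / 2 ^ j)))) = g j s" if "0 \<le> s" for j s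
  proof -
    have *: "exp (- (s * (increment j 0 \<omega> - c / 2 ^ j))) = exp (s * c / 2 ^ j) * exp (- (s * increment j 0 \<omega>))" for \<omega>
      by (simp add: exp_add[symmetric] algebra_simps)
    note mom = increment_exp_moment[OF int[OF that] J[OF that], of j]
    show "integrable M (\<lambda>\<omega>. exp (- (s * (increment j 0 \<omega> - c / 2 ^ j))))"
      unfolding * using mom by simp
    show "expectation (\<lambda>\<omega>. exp (- (s * (increment j 0 \<omega> - c / 2 ^ j)))) = g j s"
      unfolding * integral_mult_right_zero mom(2)
      by (simp add: exp_add[symmetric] g_def \<phi>_def c_def add_divide_distrib[symmetric] algebra_simps)
  qed
  have "\<exists>b. (\<forall>s\<ge>0. s * b \<le> L j s * (g j s - 1)) \<and> (\<forall>s\<ge>0. \<forall>l>0. L j s * (g j s - 1) \<le> s * b + s\<^sup>2 / l\<^sup>2 * (1 + g j (l + s)))" for j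
  proof -
    obtain b where b: "\<And>s. 0 \<le> s \<Longrightarrow> s * b \<le> L j s * (g j s - 1)"
      "\<And>s l. 0 \<le> s \<Longrightarrow> 0 < l \<Longrightarrow> L j s * (g j s - 1) \<le> s * b + s\<^sup>2 / l\<^sup>2 * (1 + g j (l + s))"
      by (rule iid_sequence.idle_limit[OF iid_increment int_j, of j])
        (auto simp: g_j L_def)
    then show ?thesis by blast
  qed
  then obtain b where b1: "\<And>j s. 0 \<le> s \<Longrightarrow> s * b j \<le> L j s * (g j s - 1)"
    and b2: "\<And>j s l. 0 \<le> s \<Longrightarrow> 0 < l \<Longrightarrow> L j s * (g j s - 1) \<le> s * b j + s\<^sup>2 / l\<^sup>2 * (1 + g j (l + s))"
    by metis
  \<comment> \<open>idle amount per unit of time at level \<open>j\<close>\<close>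
  define b' where "b' j = 2 ^ j * b j" for j
  have two: "filterlim (\<lambda>j. 2 ^ j :: real) at_top sequentially"
    by real_asymp
  have rate: "(\<lambda>j. s * b' j) \<longlonglongrightarrow> A s * \<phi> s" if s: "0 < s" for s
  proof -
    define F where "F j = 2 ^ j * (L j s * (g j s - 1))" for j
    \<comment> \<open>a bound, uniform in the mesh, for the exponential moment at the scale of one increment\<close>
    define K where "K = 1 + exp (r * (1 + s) + C * (1 + s) powr \<alpha>)"
    define e where "e j = s\<^sup>2 * (2 ^ j) powr (1 - 2 / \<alpha>) * K" for j :: nat
    have "((\<lambda>x. x * (exp (\<phi> s / x) - 1)) \<longlongrightarrow> \<phi> s) at_top"
      by real_asymp
    then have "(\<lambda>j. 2 ^ j * (g j s - 1)) \<longlonglongrightarrow> \<phi> s"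
      unfolding g_def by (rule filterlim_compose[OF _ two])
    from tendsto_mult[OF lim_laplace_tendsto[OF less_imp_le[OF s] A[OF s]] this]
    have F: "F \<longlonglongrightarrow> A s * \<phi> s"
      by (simp add: F_def[abs_def] L_def c_def algebra_simps)
    have "1 - 2 / \<alpha> < 0" using \<alpha> by (simp add: field_simps)
    then have "((\<lambda>x. x powr (1 - 2 / \<alpha>)) \<longlongrightarrow> 0) at_top"
      by (intro tendsto_neg_powr filterlim_ident)
    then have "(\<lambda>j. (2 ^ j) powr (1 - 2 / \<alpha>) :: real) \<longlonglongrightarrow> 0" by (rule filterlim_compose[OF _ two])
    then have "e \<longlonglongrightarrow> s\<^sup>2 * 0 * K" unfolding e_def by (intro tendsto_intros)
    then have Fe: "(\<lambda>j. F j - e j) \<longlonglongrightarrow> A s * \<phi> s" using tendsto_diff[OF F] by fastforce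
    have up: "s * b' j \<le> F j" for j
      using mult_left_mono[OF b1[of s j], of "2 ^ j"] s by (simp add: b'_def F_def mult.left_commute)
    have low: "F j - e j \<le> s * b' j" for j
    proof -
      define N :: real where "N = 2 ^ j"
      \<comment> \<open>an increment over time \<open>1 / N\<close> has size of order \<open>1 / l\<close>\<close>
      define l where "l = N powr (1 / \<alpha>)"
      have N: "1 \<le> N" by (simp add: N_def)
      have l: "1 \<le> l" "l \<le> N" "l powr \<alpha> = N"
        using N \<alpha> powr_mono[of "1 / \<alpha>" 1 N] by (auto simp: l_def powr_powr ge_one_powr_ge_zero)
      have ls: "l + s \<le> l * (1 + s)" using l s by (simp add: algebra_simps)
      have "(l + s) powr \<alpha> \<le> (l * (1 + s)) powr \<alpha>"
        using ls l s \<alpha> by (intro powr_mono2) auto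
      also have "\<dots> = N * (1 + s) powr \<alpha>" using l s by (simp add: powr_mult)
      finally have "C * (l + s) powr \<alpha> \<le> C * (N * (1 + s) powr \<alpha>)" using C by simp
      moreover have "r * (l + s) \<le> r * (N * (1 + s))"
        using ls l s r by (intro mult_left_mono order.trans[OF ls] mult_right_mono) auto
      ultimately have "\<phi> (l + s) \<le> N * (r * (1 + s) + C * (1 + s) powr \<alpha>)"
        by (simp add: \<phi>_def algebra_simps)
      then have "\<phi> (l + s) / N \<le> r * (1 + s) + C * (1 + s) powr \<alpha>"
        using N by (simp add: divide_le_eq mult.commute)
      then have K: "1 + g j (l + s) \<le> K" by (simp add: g_def K_def N_def)
      have "l\<^sup>2 = N powr (2 / \<alpha>)" using N by (simp add: l_def powr_power)
      then have "N * (s\<^sup>2 / l\<^sup>2) = s\<^sup>2 * N powr (1 - 2 / \<alpha>)"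
        using N by (simp add: powr_diff)
      then have e: "N * (s\<^sup>2 / l\<^sup>2 * K) = e j"
        unfolding mult.assoc[symmetric] by (simp add: e_def N_def)
      have "s\<^sup>2 / l\<^sup>2 * (1 + g j (l + s)) \<le> s\<^sup>2 / l\<^sup>2 * K" using K by (intro mult_left_mono) auto
      then have "L j s * (g j s - 1) \<le> s * b j + s\<^sup>2 / l\<^sup>2 * K"
        using b2[of s l j] s l by linarith
      then have "N * (L j s * (g j s - 1)) \<le> N * (s * b j + s\<^sup>2 / l\<^sup>2 * K)"
        using N by (intro mult_left_mono) auto
      also have "\<dots> = s * b' j + e j" unfolding distrib_left e by (simp add: b'_def N_def)
      finally show ?thesis by (simp add: F_def N_def)
    qed
    show ?thesis
      by (rule real_tendsto_sandwich[OF _ _ Fe F]) (auto simp: up low)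
  qed
  \<comment> \<open>the idle rate in continuous time, here read off at \<open>s = 1\<close>\<close>
  define \<mu> where "\<mu> = A 1 * \<phi> 1"
  have l': "b' \<longlonglongrightarrow> \<mu>" using rate[of 1] by (simp add: \<mu>_def)
  have eq: "A s * \<phi> s = s * \<mu>" if "0 < s" for s
    using LIMSEQ_unique[OF rate[OF that] tendsto_mult_left[OF l', of s]] .
  have phi: "\<phi> s = s * (r + C * s powr (\<alpha> - 1))" if "0 < s" for s
    using that by (simp add: \<phi>_def powr_diff field_simps)
  have eq': "A s * (r + C * s powr (\<alpha> - 1)) = \<mu>" if "0 < s" for s
    using eq[OF that] that by (simp add: phi)
  have "((\<lambda>s. s powr (\<alpha> - 1)) \<longlongrightarrow> 0) (at_right (0::real))"
    using \<alpha> by real_asymp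
  then have "((\<lambda>s. A s * (r + C * s powr (\<alpha> - 1))) \<longlongrightarrow> 1 * (r + C * 0)) (at_right 0)"
    by (intro tendsto_intros A0)
  moreover have "((\<lambda>s. A s * (r + C * s powr (\<alpha> - 1))) \<longlongrightarrow> \<mu>) (at_right 0)"
    by (rule tendsto_eventually) (auto simp: eventually_at_filter eq')
  ultimately have "\<mu> = r" using tendsto_unique[of "at_right (0::real)"] by fastforce
  with eq'[OF s] have "A s * (r + C * s powr (\<alpha> - 1)) = r" by simp
  moreover have "0 < r + C * s powr (\<alpha> - 1)" using r C by (simp add: add_pos_nonneg)
  ultimately have "A s = r / (r + C * s powr (\<alpha> - 1))" by (simp add: field_simps)
  also have "\<dots> = 1 / (1 + C / r * s powr (\<alpha> - 1))" using r by (simp add: field_simps)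
  finally show ?thesis .
qed

section \<open>Asymptotic independence of the two workloads\<close>

text \<open>The transform decreases in time, as it does on every grid.\<close>

lemma workload_transform_ge_limit:
  assumes s: "0 \<le> s" and A: "workload_transform c s \<longlonglongrightarrow> A"
  shows "A \<le> workload_transform c s T"
proof (rule decseq_ge[OF _ A], rule decseq_SucI)
  fix T
  have "laplace j (c / 2 ^ j) s (Suc T * 2 ^ j) \<le> laplace j (c / 2 ^ j) s (T * 2 ^ j)" for j
    by (rule decseqD[OF iid_sequence.decseq_laplace[OF iid_increment s]]) simp
  then show "workload_transform c s (Suc T) \<le> workload_transform c s T"
    by (intro LIMSEQ_le[OF laplace_tendsto[OF s] laplace_tendsto[OF s]]) blast
qed

lemma downstream_eq:
  "downstream_workload J c1 c2 t \<omega> = upstream_workload J c2 t \<omega> - upstream_workload J c1 t \<omega>"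
  by (simp add: downstream_workload_def upstream_workload_def)

text \<open>The bound of \<open>asymptotic_independence_bound\<close> with window length \<open>T\<close>, after the mesh has gone to zero
and then time to infinity. In heavy traffic \<open>s2\<close> tends to zero, which removes the first and the last
term; the middle one is made small by the choice of \<open>T\<close>.\<close>

lemma joint_transform_bound:
  assumes s: "0 \<le> s1" "0 \<le> s2" and c: "c2 \<le> c1"
    and A1: "workload_transform c1 s1 \<longlonglongrightarrow> A1" and A2: "workload_transform c2 s2 \<longlonglongrightarrow> A2" and A3: "workload_transform c1 s2 \<longlonglongrightarrow> A3"
    and B: "(\<lambda>t. expectation (\<lambda>\<omega>. exp (- (s1 * upstream_workload J c1 (real t) \<omega>) - s2 * downstream_workload J c1 c2 (real t) \<omega>))) \<longlonglongrightarrow> B"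
  shows "\<bar>B - A1 * A2\<bar> \<le> (1 - A3) + 2 * (workload_transform c1 s1 T - A1) + 2 * (1 - workload_transform c2 s2 T)"
proof -
  define G where "G t = expectation (\<lambda>\<omega>. exp (- (s1 * upstream_workload J c1 (real t) \<omega>) - s2 * downstream_workload J c1 c2 (real t) \<omega>))" for t
  define V where "V j n \<omega> = exp (- (s1 * queue j (c1 / 2 ^ j) 0 n \<omega>) - s2 * (queue j (c2 / 2 ^ j) 0 n \<omega> - queue j (c1 / 2 ^ j) 0 n \<omega>))" for j n \<omega>
  have V: "(\<lambda>j. expectation (V j (t * 2 ^ j))) \<longlonglongrightarrow> G t" for t
    unfolding G_def
  proof (rule integral_dominated_convergence[where w="\<lambda>_. 1"])
    show "AE \<omega> in M. (\<lambda>j. V j (t * 2 ^ j) \<omega>) \<longlonglongrightarrow> exp (- (s1 * upstream_workload J c1 (real t) \<omega>) - s2 * downstream_workload J c1 c2 (real t) \<omega>)"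
      unfolding V_def downstream_eq by (intro AE_I2 tendsto_intros queue_tendsto)
    show "AE \<omega> in M. norm (V j (t * 2 ^ j) \<omega>) \<le> 1" for j
    proof (rule AE_I2)
      fix \<omega>
      have "c2 / 2 ^ j \<le> c1 / 2 ^ j" using c by (simp add: divide_right_mono)
      from iid_sequence.queue_antimono[OF iid_increment this, of j 0 "t * 2 ^ j" \<omega>]
        iid_sequence.queue_nonneg[OF iid_increment, of j "c1 / 2 ^ j" 0 "t * 2 ^ j" \<omega>] s
      show "norm (V j (t * 2 ^ j) \<omega>) \<le> 1"
        by (simp add: V_def) (smt (verit) mult_nonneg_nonneg)
    qed
  qed (auto simp: V_def[abs_def] downstream_eq)
  \<comment> \<open>mesh to zero\<close>
  have pre: "\<bar>G (u + T) - workload_transform c1 s1 T * workload_transform c2 s2 u\<bar>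
      \<le> (1 - workload_transform c1 s2 (u + T)) + (workload_transform c1 s1 T - workload_transform c1 s1 (u + T))
        + (workload_transform c2 s2 (u + T) - workload_transform c2 s2 u * workload_transform c2 s2 T) + (1 - workload_transform c2 s2 T)" for u
  proof (rule LIMSEQ_le)
    let ?l = "\<lambda>j c s t. laplace j (c / 2 ^ j) s (t * 2 ^ j)"
    show "(\<lambda>j. \<bar>expectation (V j ((u + T) * 2 ^ j)) - ?l j c1 s1 T * ?l j c2 s2 u\<bar>) \<longlonglongrightarrow> \<bar>G (u + T) - workload_transform c1 s1 T * workload_transform c2 s2 u\<bar>"
      by (intro tendsto_intros V laplace_tendsto s)
    show "(\<lambda>j. (1 - ?l j c1 s2 (u + T)) + (?l j c1 s1 T - ?l j c1 s1 (u + T))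
        + (?l j c2 s2 (u + T) - ?l j c2 s2 u * ?l j c2 s2 T) + (1 - ?l j c2 s2 T)) \<longlonglongrightarrow> (1 - workload_transform c1 s2 (u + T)) + (workload_transform c1 s1 T - workload_transform c1 s1 (u + T))
        + (workload_transform c2 s2 (u + T) - workload_transform c2 s2 u * workload_transform c2 s2 T) + (1 - workload_transform c2 s2 T)"
      by (intro tendsto_intros laplace_tendsto s)
    have "c2 / 2 ^ j \<le> c1 / 2 ^ j" for j using c by (simp add: divide_right_mono)
    from iid_sequence.asymptotic_independence_bound[OF iid_increment s this]
    show "\<exists>N. \<forall>j\<ge>N. \<bar>expectation (V j ((u + T) * 2 ^ j)) - ?l j c1 s1 T * ?l j c2 s2 u\<bar> \<le> (1 - ?l j c1 s2 (u + T)) + (?l j c1 s1 T - ?l j c1 s1 (u + T))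
        + (?l j c2 s2 (u + T) - ?l j c2 s2 u * ?l j c2 s2 T) + (1 - ?l j c2 s2 T)"
      by (auto simp: V_def[abs_def] distrib_right)
  qed
  have shift: "(\<lambda>u. X (u + T)) \<longlonglongrightarrow> x" if "X \<longlonglongrightarrow> x" for X and x :: real
    using that by (rule LIMSEQ_ignore_initial_segment)
  \<comment> \<open>time to infinity\<close>
  have "\<bar>B - workload_transform c1 s1 T * A2\<bar> \<le> (1 - A3) + (workload_transform c1 s1 T - A1) + (A2 - A2 * workload_transform c2 s2 T) + (1 - workload_transform c2 s2 T)"
  proof (rule LIMSEQ_le)
    show "(\<lambda>u. \<bar>G (u + T) - workload_transform c1 s1 T * workload_transform c2 s2 u\<bar>) \<longlonglongrightarrow> \<bar>B - workload_transform c1 s1 T * A2\<bar>"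
      by (intro tendsto_intros shift A2 B[folded G_def])
    show "(\<lambda>u. (1 - workload_transform c1 s2 (u + T)) + (workload_transform c1 s1 T - workload_transform c1 s1 (u + T))
        + (workload_transform c2 s2 (u + T) - workload_transform c2 s2 u * workload_transform c2 s2 T) + (1 - workload_transform c2 s2 T)) \<longlonglongrightarrow> (1 - A3) + (workload_transform c1 s1 T - A1) + (A2 - A2 * workload_transform c2 s2 T) + (1 - workload_transform c2 s2 T)"
      by (intro tendsto_intros shift A1 A2 A3)
  qed (use pre in auto)
  moreover have A2b: "0 \<le> A2" "A2 \<le> 1"
    using LIMSEQ_le_const[OF A2, of 0] LIMSEQ_le_const2[OF A2, of 1] workload_transform_bounds[OF s(2)] by auto
  moreover have "A2 * (1 - workload_transform c2 s2 T) \<le> 1 * (1 - workload_transform c2 s2 T)"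
    using A2b workload_transform_bounds[OF s(2)] by (intro mult_right_mono) auto
  moreover have "\<bar>workload_transform c1 s1 T * A2 - A1 * A2\<bar> \<le> workload_transform c1 s1 T - A1"
  proof -
    have "A1 \<le> workload_transform c1 s1 T" by (rule workload_transform_ge_limit[OF s(1) A1])
    then have "\<bar>workload_transform c1 s1 T * A2 - A1 * A2\<bar> = (workload_transform c1 s1 T - A1) * A2"
      using A2b by (simp add: left_diff_distrib[symmetric] abs_mult)
    also have "\<dots> \<le> (workload_transform c1 s1 T - A1) * 1"
      using A2b \<open>A1 \<le> _\<close> by (intro mult_left_mono) auto
    finally show ?thesis by simp
  qed
  ultimately show ?thesis by (simp add: right_diff_distrib)
qed

text \<open>Over a window of length \<open>T\<close> the contents of the two queues differ by at most \<open>(c1 - c2) * T\<close>. This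
controls the slow queue by the fast one, uniformly in the slow rate.\<close>

lemma workload_transform_rate_le:
  assumes s: "0 \<le> s" and c: "c2 \<le> c1"
  shows "exp (- (s * (c1 - c2) * T)) * workload_transform c1 s T \<le> workload_transform c2 s T"
proof -
  have "expectation (\<lambda>\<omega>. exp (- (s * (c1 - c2) * T)) * exp (- (s * upstream_workload J c1 (real T) \<omega>)))
     \<le> expectation (\<lambda>\<omega>. exp (- (s * upstream_workload J c2 (real T) \<omega>)))"
  proof (rule integral_mono)
    fix \<omega> assume \<omega>: "\<omega> \<in> space M"
    have "(INF u\<in>{0..real T}. net_input J c1 u \<omega>) \<le> (INF u\<in>{0..real T}. net_input J c2 u \<omega>)"
    proof (rule cINF_mono)
      show "bdd_below ((\<lambda>u. net_input J c1 u \<omega>) ` {0..real T})" by (rule path_bdd_below[OF \<omega>]) simp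
      fix u assume u: "u \<in> {0..real T}"
      then have "net_input J c1 u \<omega> \<le> net_input J c2 u \<omega>"
        using c by (simp add: net_input_def mult_right_mono)
      with u show "\<exists>v\<in>{0..real T}. net_input J c1 v \<omega> \<le> net_input J c2 u \<omega>" by blast
    qed simp
    then have "upstream_workload J c2 T \<omega> \<le> upstream_workload J c1 T \<omega> + (c1 - c2) * T"
      by (simp add: upstream_workload_def regulator_def net_input_def algebra_simps)
    then have "s * upstream_workload J c2 T \<omega> \<le> s * (upstream_workload J c1 T \<omega> + (c1 - c2) * T)"
      using s by (rule mult_left_mono)
    then show "exp (- (s * (c1 - c2) * T)) * exp (- (s * upstream_workload J c1 (real T) \<omega>)) \<le> exp (- (s * upstream_workload J c2 (real T) \<omega>))"
      by (simp add: exp_add[symmetric] algebra_simps)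
  qed (use s integrable_exp_upstream in auto)
  then show ?thesis by (simp add: workload_transform_def)
qed

section \<open>Stationary workloads and heavy traffic\<close>

lemma downstream_nonneg:
  assumes \<omega>: "\<omega> \<in> space M" and c: "c2 \<le> c1"
  shows "0 \<le> downstream_workload J c1 c2 (real T) \<omega>"
proof -
  have "upstream_workload J c1 (real T) \<omega> \<le> upstream_workload J c2 (real T) \<omega>"
  proof (rule LIMSEQ_le[OF queue_tendsto[OF \<omega>] queue_tendsto[OF \<omega>]], intro exI allI impI)
    show "queue j (c1 / 2 ^ j) 0 (T * 2 ^ j) \<omega> \<le> queue j (c2 / 2 ^ j) 0 (T * 2 ^ j) \<omega>" for j
      by (rule iid_sequence.queue_antimono[OF iid_increment]) (simp add: c divide_right_mono)
  qed
  then show ?thesis by (simp add: downstream_eq)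
qed

lemma stationary_nonneg:
  assumes st: "stationary_workloads M J c1 c2 N Q1 Q2" and c: "c2 \<le> c1"
  shows "AE \<omega> in N. 0 \<le> Q1 \<omega> \<and> 0 \<le> Q2 \<omega>"
proof -
  interpret N: prob_space N using st unfolding stationary_workloads_def by blast
  have [measurable]: "Q1 \<in> borel_measurable N" "Q2 \<in> borel_measurable N"
    using st unfolding stationary_workloads_def by auto
  define f :: "real \<times> real \<Rightarrow> real" where "f p = min 1 (max 0 (- fst p) + max 0 (- snd p))" for p
  have f: "continuous_on UNIV f" unfolding f_def by (intro continuous_intros)
  have f_0: "f (x, y) = 0" if "0 \<le> x" "0 \<le> y" for x y using that by (simp add: f_def)
  have f_bounds: "0 \<le> f p" "f p \<le> 1" for p by (auto simp: f_def)
  then have "bounded (range f)" by (intro boundedI[of _ 1]) (auto simp: abs_le_iff intro: order.trans[of _ 0])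
  then have lim: "((\<lambda>t. \<integral>\<omega>. f (upstream_workload J c1 t \<omega>, downstream_workload J c1 c2 t \<omega>) \<partial>M) \<longlongrightarrow> (\<integral>\<omega>. f (Q1 \<omega>, Q2 \<omega>) \<partial>N)) at_top"
    using st f unfolding stationary_workloads_def converges_in_distribution_def by blast
  have "(\<lambda>T. \<integral>\<omega>. f (upstream_workload J c1 (real T) \<omega>, downstream_workload J c1 c2 (real T) \<omega>) \<partial>M) \<longlonglongrightarrow> (\<integral>\<omega>. f (Q1 \<omega>, Q2 \<omega>) \<partial>N)"
    by (rule filterlim_compose[OF lim filterlim_real_sequentially])
  moreover have "(\<integral>\<omega>. f (upstream_workload J c1 (real T) \<omega>, downstream_workload J c1 c2 (real T) \<omega>) \<partial>M) = 0" for T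
  proof -
    have "(\<integral>\<omega>. f (upstream_workload J c1 (real T) \<omega>, downstream_workload J c1 c2 (real T) \<omega>) \<partial>M) = (\<integral>\<omega>. 0 \<partial>M)"
      by (rule Bochner_Integration.integral_cong)
        (auto intro!: f_0 upstream_nonneg downstream_nonneg[OF _ c])
    then show ?thesis by simp
  qed
  ultimately have zero: "(\<integral>\<omega>. f (Q1 \<omega>, Q2 \<omega>) \<partial>N) = 0"
    using LIMSEQ_unique[OF _ tendsto_const] by force
  have meas: "(\<lambda>\<omega>. f (Q1 \<omega>, Q2 \<omega>)) \<in> borel_measurable N" unfolding f_def by simp
  have "integrable N (\<lambda>\<omega>. f (Q1 \<omega>, Q2 \<omega>))"
    by (rule N.integrable_const_bound[where B=1]) (use f_bounds meas in auto)
  then have "AE \<omega> in N. f (Q1 \<omega>, Q2 \<omega>) = 0"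
    using integral_nonneg_eq_0_iff_AE[of N "\<lambda>\<omega>. f (Q1 \<omega>, Q2 \<omega>)"] f_bounds zero by auto
  then show ?thesis
    by eventually_elim (auto simp: f_def min_def max_def split: if_splits)
qed

text \<open>The exponential is not bounded on the whole plane, so convergence in distribution is applied to a
truncation that agrees with it on the quadrant carrying all the laws involved.\<close>

lemma stationary_joint_transform:
  assumes st: "stationary_workloads M J c1 c2 N Q1 Q2" and c: "c2 \<le> c1" and s: "0 \<le> s1" "0 \<le> s2"
  shows "(\<lambda>T. expectation (\<lambda>\<omega>. exp (- (s1 * upstream_workload J c1 (real T) \<omega>) - s2 * downstream_workload J c1 c2 (real T) \<omega>)))
    \<longlonglongrightarrow> (\<integral>\<omega>. exp (- (s1 * Q1 \<omega>) - s2 * Q2 \<omega>) \<partial>N)"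
proof -
  have [measurable]: "Q1 \<in> borel_measurable N" "Q2 \<in> borel_measurable N"
    using st unfolding stationary_workloads_def by auto
  define f :: "real \<times> real \<Rightarrow> real" where "f p = exp (- (s1 * max 0 (fst p)) - s2 * max 0 (snd p))" for p
  have f: "continuous_on UNIV f" unfolding f_def by (intro continuous_intros)
  have f_eq: "f (x, y) = exp (- (s1 * x) - s2 * y)" if "0 \<le> x" "0 \<le> y" for x y
    using that by (simp add: f_def)
  have "norm (f p) \<le> 1" for p
  proof -
    have "0 \<le> s1 * max 0 (fst p)" "0 \<le> s2 * max 0 (snd p)" using s by auto
    then show ?thesis by (simp add: f_def)
  qed
  then have "bounded (range f)" by (intro boundedI[of _ 1]) auto
  then have lim: "((\<lambda>t. \<integral>\<omega>. f (upstream_workload J c1 t \<omega>, downstream_workload J c1 c2 t \<omega>) \<partial>M) \<longlongrightarrow> (\<integral>\<omega>. f (Q1 \<omega>, Q2 \<omega>) \<partial>N)) at_top"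
    using st f unfolding stationary_workloads_def converges_in_distribution_def by blast
  have "(\<lambda>T. \<integral>\<omega>. f (upstream_workload J c1 (real T) \<omega>, downstream_workload J c1 c2 (real T) \<omega>) \<partial>M) \<longlonglongrightarrow> (\<integral>\<omega>. f (Q1 \<omega>, Q2 \<omega>) \<partial>N)"
    by (rule filterlim_compose[OF lim filterlim_real_sequentially])
  moreover have "(\<integral>\<omega>. f (upstream_workload J c1 (real T) \<omega>, downstream_workload J c1 c2 (real T) \<omega>) \<partial>M)
      = expectation (\<lambda>\<omega>. exp (- (s1 * upstream_workload J c1 (real T) \<omega>) - s2 * downstream_workload J c1 c2 (real T) \<omega>))" for T
    by (rule Bochner_Integration.integral_cong) (auto intro!: f_eq upstream_nonneg downstream_nonneg[OF _ c])
  moreover have "(\<integral>\<omega>. f (Q1 \<omega>, Q2 \<omega>) \<partial>N) = (\<integral>\<omega>. exp (- (s1 * Q1 \<omega>) - s2 * Q2 \<omega>) \<partial>N)"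
  proof (rule integral_cong_AE)
    show "AE \<omega> in N. f (Q1 \<omega>, Q2 \<omega>) = exp (- (s1 * Q1 \<omega>) - s2 * Q2 \<omega>)"
      using stationary_nonneg[OF st c] by eventually_elim (auto intro!: f_eq)
  qed (auto simp: f_def)
  ultimately show ?thesis by simp
qed

end

lemma (in prob_space) laplace_transform_at_0:
  fixes Q :: "'a \<Rightarrow> real"
  assumes [measurable]: "Q \<in> borel_measurable M" and nonneg: "AE \<omega> in M. 0 \<le> Q \<omega>"
  shows "((\<lambda>s. expectation (\<lambda>\<omega>. exp (- (s * Q \<omega>)))) \<longlongrightarrow> 1) (at_right 0)"
  unfolding tendsto_at_iff_sequentially comp_def
proof (intro allI impI)
  fix S :: "nat \<Rightarrow> real" assume S: "\<forall>i. S i \<in> {0<..} - {0}" "S \<longlonglongrightarrow> 0"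
  have "(\<lambda>i. expectation (\<lambda>\<omega>. exp (- (S i * Q \<omega>)))) \<longlonglongrightarrow> expectation (\<lambda>_. 1)"
  proof (rule integral_dominated_convergence[where w="\<lambda>_. 1"])
    have "(\<lambda>i. exp (- (S i * Q \<omega>))) \<longlonglongrightarrow> exp (- (0 * Q \<omega>))" for \<omega>
      by (intro tendsto_intros S)
    then show "AE \<omega> in M. (\<lambda>i. exp (- (S i * Q \<omega>))) \<longlonglongrightarrow> 1" by simp
    show "AE \<omega> in M. norm (exp (- (S i * Q \<omega>))) \<le> 1" for i
      using nonneg by eventually_elim (use S(1) in \<open>auto simp: less_imp_le\<close>)
  qed auto
  then show "(\<lambda>i. expectation (\<lambda>\<omega>. exp (- (S i * Q \<omega>)))) \<longlonglongrightarrow> 1" by (simp add: prob_space)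
qed

context levy_process
begin

text \<open>The transforms of the upstream and of the total workload, in the scaled variables, are exact for each
\<open>\<epsilon>\<close>; the limit \<open>\<epsilon> \<rightarrow> 0\<close> is needed for the dependence and for passing from the total to the downstream
workload. The window length \<open>T\<close> is chosen first, then \<open>\<epsilon>\<close>.\<close>

lemma stable_heavy_traffic:
  fixes N :: "real \<Rightarrow> 'b measure" and Q1 Q2 :: "real \<Rightarrow> 'b \<Rightarrow> real"
  assumes \<alpha>: "1 < \<alpha>" "\<alpha> < 2" and C: "0 < C" and r: "0 < r"
    and int: "\<And>s. 0 \<le> s \<Longrightarrow> integrable M (\<lambda>\<omega>. exp (- (s * J 1 \<omega>)))"
    and J: "\<And>s. 0 \<le> s \<Longrightarrow> expectation (\<lambda>\<omega>. exp (- (s * J 1 \<omega>))) = exp (C * s powr \<alpha> - s * m)"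
    and st: "\<And>\<epsilon>. 0 < \<epsilon> \<Longrightarrow> \<epsilon> < r \<Longrightarrow> stationary_workloads M J (m + r) (m + \<epsilon>) (N \<epsilon>) (Q1 \<epsilon>) (Q2 \<epsilon>)"
    and s: "0 \<le> s1" "0 \<le> s2"
  shows "((\<lambda>\<epsilon>. \<integral>\<omega>. exp (- (s1 * (r / C) powr inverse (\<alpha> - 1) * Q1 \<epsilon> \<omega>) - s2 * (\<epsilon> / C) powr inverse (\<alpha> - 1) * Q2 \<epsilon> \<omega>) \<partial>N \<epsilon>)
           \<longlongrightarrow> 1 / (1 + s1 powr (\<alpha> - 1)) * (1 / (1 + s2 powr (\<alpha> - 1)))) (at_right 0)"
proof -
  define a where "a \<rho> s = 1 / (1 + C / \<rho> * s powr (\<alpha> - 1))" for \<rho> s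
  define \<beta> where "\<beta> = inverse (\<alpha> - 1)"
  have marginal: "workload_transform (m + r) s \<longlonglongrightarrow> a r s" "workload_transform (m + \<epsilon>) s \<longlonglongrightarrow> a \<epsilon> s"
    if \<epsilon>: "0 < \<epsilon>" "\<epsilon> < r" and s: "0 \<le> s" for \<epsilon> s
  proof -
    note st = st[OF \<epsilon>]
    interpret N: prob_space "N \<epsilon>" using st unfolding stationary_workloads_def by blast
    have meas [measurable]: "Q1 \<epsilon> \<in> borel_measurable (N \<epsilon>)" "Q2 \<epsilon> \<in> borel_measurable (N \<epsilon>)"
      using st unfolding stationary_workloads_def by auto
    have c: "m + \<epsilon> \<le> m + r" using \<epsilon> by simp
    have lim1: "workload_transform (m + r) s \<longlonglongrightarrow> (\<integral>\<omega>. exp (- (s * Q1 \<epsilon> \<omega>)) \<partial>N \<epsilon>)" if "0 < s" for s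
      using stationary_joint_transform[OF st c, of s 0] that by (simp add: workload_transform_def[abs_def])
    \<comment> \<open>the sum of the two workloads is a single queue with the slower rate\<close>
    have lim2: "workload_transform (m + \<epsilon>) s \<longlonglongrightarrow> (\<integral>\<omega>. exp (- (s * (Q1 \<epsilon> \<omega> + Q2 \<epsilon> \<omega>))) \<partial>N \<epsilon>)" if "0 < s" for s
      using stationary_joint_transform[OF st c, of s s] that
      by (simp add: workload_transform_def[abs_def] downstream_eq algebra_simps)
    have nonneg: "AE \<omega> in N \<epsilon>. 0 \<le> Q1 \<epsilon> \<omega>" "AE \<omega> in N \<epsilon>. 0 \<le> Q1 \<epsilon> \<omega> + Q2 \<epsilon> \<omega>"
      by (use stationary_nonneg[OF st c] in eventually_elim, simp)+
    have zero: "workload_transform c 0 \<longlonglongrightarrow> a \<rho> 0" for c \<rho>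
      by (simp add: workload_transform_def[abs_def] prob_space a_def)
    show "workload_transform (m + r) s \<longlonglongrightarrow> a r s"
    proof (cases "s = 0")
      case False
      with s have s: "0 < s" by simp
      from lim1[OF s] stable_pollaczek_khinchine[OF \<alpha> C r int J lim1 N.laplace_transform_at_0[OF meas(1) nonneg(1)] s]
      show ?thesis by (simp add: a_def)
    qed (simp add: zero)
    show "workload_transform (m + \<epsilon>) s \<longlonglongrightarrow> a \<epsilon> s"
    proof (cases "s = 0")
      case False
      with s have s: "0 < s" by simp
      have "(\<lambda>\<omega>. Q1 \<epsilon> \<omega> + Q2 \<epsilon> \<omega>) \<in> borel_measurable (N \<epsilon>)" by measurable
      from lim2[OF s] stable_pollaczek_khinchine[OF \<alpha> C \<epsilon>(1) int J lim2 N.laplace_transform_at_0[OF this nonneg(2)] s]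
      show ?thesis by (simp add: a_def)
    qed (simp add: zero)
  qed
  have scaling: "a \<rho> (s * (\<rho> / C) powr \<beta>) = 1 / (1 + s powr (\<alpha> - 1))" if "0 < \<rho>" "0 \<le> s" for \<rho> s
  proof -
    have "(s * (\<rho> / C) powr \<beta>) powr (\<alpha> - 1) = s powr (\<alpha> - 1) * (\<rho> / C)"
      using that C \<alpha> by (simp add: powr_mult powr_powr \<beta>_def)
    then show ?thesis using that C by (simp add: a_def)
  qed
  define \<sigma>1 where "\<sigma>1 = s1 * (r / C) powr \<beta>"
  define \<sigma>2 where "\<sigma>2 \<epsilon> = s2 * (\<epsilon> / C) powr \<beta>" for \<epsilon>
  define I where "I \<epsilon> = (\<integral>\<omega>. exp (- (\<sigma>1 * Q1 \<epsilon> \<omega>) - \<sigma>2 \<epsilon> * Q2 \<epsilon> \<omega>) \<partial>N \<epsilon>)" for \<epsilon>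
  define P where "P = 1 / (1 + s1 powr (\<alpha> - 1)) * (1 / (1 + s2 powr (\<alpha> - 1)))"
  define rest where "rest T x = (1 - a r x) + 2 * (1 - exp (- (x * r * real T)) * a r x)" for T x
  have \<sigma>: "0 \<le> \<sigma>1" "0 \<le> \<sigma>2 \<epsilon>" for \<epsilon> using s by (auto simp: \<sigma>1_def \<sigma>2_def)
  have bound: "\<bar>I \<epsilon> - P\<bar> \<le> 2 * (workload_transform (m + r) \<sigma>1 T - a r \<sigma>1) + rest T (\<sigma>2 \<epsilon>)" if \<epsilon>: "0 < \<epsilon>" "\<epsilon> < r" for \<epsilon> T
  proof -
    have c: "m + \<epsilon> \<le> m + r" using \<epsilon> by simp
    have P: "P = a r \<sigma>1 * a \<epsilon> (\<sigma>2 \<epsilon>)"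
      unfolding P_def \<sigma>1_def \<sigma>2_def using scaling[OF r s(1)] scaling[OF \<epsilon>(1) s(2)] by simp
    have 1: "\<bar>I \<epsilon> - P\<bar> \<le> (1 - a r (\<sigma>2 \<epsilon>)) + 2 * (workload_transform (m + r) \<sigma>1 T - a r \<sigma>1) + 2 * (1 - workload_transform (m + \<epsilon>) (\<sigma>2 \<epsilon>) T)"
      unfolding P I_def
      by (rule joint_transform_bound[OF \<sigma> c marginal(1)[OF \<epsilon> \<sigma>(1)] marginal(2)[OF \<epsilon> \<sigma>(2)] marginal(1)[OF \<epsilon> \<sigma>(2)]
            stationary_joint_transform[OF st[OF \<epsilon>] c \<sigma>]])
    have "exp (- (\<sigma>2 \<epsilon> * r * real T)) * a r (\<sigma>2 \<epsilon>) \<le> exp (- (\<sigma>2 \<epsilon> * (m + r - (m + \<epsilon>)) * real T)) * workload_transform (m + r) (\<sigma>2 \<epsilon>) T"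
    proof (rule mult_mono)
      show "a r (\<sigma>2 \<epsilon>) \<le> workload_transform (m + r) (\<sigma>2 \<epsilon>) T"
        by (rule workload_transform_ge_limit[OF \<sigma>(2) marginal(1)[OF \<epsilon> \<sigma>(2)]])
      show "0 \<le> a r (\<sigma>2 \<epsilon>)" using C r by (simp add: a_def add_nonneg_nonneg)
      show "exp (- (\<sigma>2 \<epsilon> * r * real T)) \<le> exp (- (\<sigma>2 \<epsilon> * (m + r - (m + \<epsilon>)) * real T))"
        using \<sigma>(2)[of \<epsilon>] \<epsilon> by (simp add: mult_left_mono mult_right_mono)
    qed simp
    also have "\<dots> \<le> workload_transform (m + \<epsilon>) (\<sigma>2 \<epsilon>) T" by (rule workload_transform_rate_le[OF \<sigma>(2) c])
    finally show ?thesis using 1 by (simp add: rest_def)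
  qed
  have \<beta>: "0 < \<beta>" using \<alpha> by (simp add: \<beta>_def)
  have "((\<lambda>\<epsilon>. (\<epsilon> / C) powr \<beta>) \<longlongrightarrow> 0) (at_right 0)"
    using \<beta> C by real_asymp
  then have "(\<sigma>2 \<longlongrightarrow> s2 * 0) (at_right 0)" unfolding \<sigma>2_def by (intro tendsto_intros)
  then have \<sigma>2: "(\<sigma>2 \<longlongrightarrow> 0) (at_right 0)" by simp
  have "((\<lambda>\<epsilon>. (\<sigma>2 \<epsilon>) powr (\<alpha> - 1)) \<longlongrightarrow> 0 powr (\<alpha> - 1)) (at_right 0)"
    using \<alpha> \<sigma> by (intro tendsto_powr2 \<sigma>2 tendsto_const) auto
  then have "((\<lambda>\<epsilon>. a r (\<sigma>2 \<epsilon>)) \<longlongrightarrow> 1 / (1 + C / r * 0)) (at_right 0)"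
    unfolding a_def by (intro tendsto_intros) auto
  then have a0: "((\<lambda>\<epsilon>. a r (\<sigma>2 \<epsilon>)) \<longlongrightarrow> 1) (at_right 0)" by simp
  have rest: "((\<lambda>\<epsilon>. rest T (\<sigma>2 \<epsilon>)) \<longlongrightarrow> 0) (at_right 0)" for T
  proof -
    have "((\<lambda>\<epsilon>. rest T (\<sigma>2 \<epsilon>)) \<longlongrightarrow> (1 - 1) + 2 * (1 - exp (- (0 * r * real T)) * 1)) (at_right 0)"
      unfolding rest_def by (intro tendsto_intros a0 \<sigma>2)
    then show ?thesis by simp
  qed
  have "(I \<longlongrightarrow> P) (at_right 0)"
  proof (rule tendstoI)
    fix e :: real assume e: "0 < e"
    have "workload_transform (m + r) \<sigma>1 \<longlonglongrightarrow> a r \<sigma>1"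
      using marginal(1)[of "r / 2" \<sigma>1] r \<sigma> by simp
    then have "\<forall>\<^sub>F T in sequentially. workload_transform (m + r) \<sigma>1 T < a r \<sigma>1 + e / 4"
      by (rule order_tendstoD(2)) (use e in simp)
    then obtain T where T: "workload_transform (m + r) \<sigma>1 T < a r \<sigma>1 + e / 4"
      by (auto simp: eventually_sequentially)
    have "\<forall>\<^sub>F \<epsilon> in at_right 0. rest T (\<sigma>2 \<epsilon>) < e / 2"
      by (rule order_tendstoD(2)[OF rest]) (use e in simp)
    moreover have "\<forall>\<^sub>F \<epsilon> in at_right 0. \<epsilon> \<in> {0<..<r}"
      by (rule eventually_at_right_real[OF r])
    ultimately show "\<forall>\<^sub>F \<epsilon> in at_right 0. dist (I \<epsilon>) P < e"
    proof eventually_elim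
      case (elim \<epsilon>)
      then show ?case using bound[of \<epsilon> T] T by (simp add: dist_real_def)
    qed
  qed
  then show ?thesis by (simp add: I_def[abs_def] P_def \<sigma>1_def \<sigma>2_def \<beta>_def)
qed

end

theorem proposition4p5:
  fixes M :: "'a measure" and J :: "real \<Rightarrow> 'a \<Rightarrow> real"
    and N :: "real \<Rightarrow> 'b measure" and Q1 Q2 :: "real \<Rightarrow> 'b \<Rightarrow> real"
    and \<alpha> C \<beta> r s1 s2 :: real
  assumes alpha: "1 < \<alpha>" "\<alpha> < 2"
    and C: "C = inverse (cos (pi * (\<alpha> / 2 - 1)))"
    and beta: "\<beta> = inverse (\<alpha> - 1)"
    and spectrally_positive: "spectrally_positive_levy M J"
    and stable: "stable_levy_motion M \<alpha> J"
    and integrable: "integrable M (J 1)"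
    and normalized: "\<And>s. 0 \<le> s \<Longrightarrow>
      ln (\<integral>\<omega>. exp (- s * (J 1 \<omega> - (\<integral>\<omega>'. J 1 \<omega>' \<partial>M))) \<partial>M) = C * s powr \<alpha>"
    and r: "0 < r"
    and stationary: "\<And>\<epsilon>. 0 < \<epsilon> \<Longrightarrow> \<epsilon> < r \<Longrightarrow>
      stationary_workloads M J ((\<integral>\<omega>. J 1 \<omega> \<partial>M) + r) ((\<integral>\<omega>. J 1 \<omega> \<partial>M) + \<epsilon>) (N \<epsilon>) (Q1 \<epsilon>) (Q2 \<epsilon>)"
    and s: "0 \<le> s1" "0 \<le> s2"
  shows "((\<lambda>\<epsilon>. \<integral>\<omega>. exp (- s1 * (r / C) powr \<beta> * Q1 \<epsilon> \<omega> - s2 * (\<epsilon> / C) powr \<beta> * Q2 \<epsilon> \<omega>) \<partial>N \<epsilon>)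
           \<longlongrightarrow> 1 / (1 + s1 powr (\<alpha> - 1)) * (1 / (1 + s2 powr (\<alpha> - 1)))) (at_right 0)"
proof -
  interpret levy_process M J using spectrally_positive unfolding spectrally_positive_levy_def by blast
  define m where "m = (\<integral>\<omega>. J 1 \<omega> \<partial>M)"
  have "0 < cos (pi * (\<alpha> / 2 - 1))"
  proof (rule cos_gt_zero_pi)
    have "pi * (- 1 / 2) < pi * (\<alpha> / 2 - 1)" using alpha by (intro mult_strict_left_mono) auto
    then show "- (pi / 2) < pi * (\<alpha> / 2 - 1)" by simp
    have "pi * (\<alpha> / 2 - 1) < pi * (1 / 2)" using alpha by (intro mult_strict_left_mono) auto
    then show "pi * (\<alpha> / 2 - 1) < pi / 2" by simp
  qed
  then have C0: "0 < C" by (simp add: C)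
  have moment: "integrable M (\<lambda>\<omega>. exp (- (s * J 1 \<omega>))) \<and> expectation (\<lambda>\<omega>. exp (- (s * J 1 \<omega>))) = exp (C * s powr \<alpha> - s * m)"
    if s: "0 \<le> s" for s
  proof (cases "s = 0")
    case False
    define X where "X \<omega> = exp (- s * (J 1 \<omega> - m))" for \<omega>
    have ln: "ln (expectation X) = C * s powr \<alpha>"
      using normalized[OF s] by (simp add: X_def[abs_def] m_def)
    have "0 < C * s powr \<alpha>" using C0 False by simp
    \<comment> \<open>a non-integrable \<open>X\<close> would have expectation \<open>0\<close>, and \<open>ln 0 = 0\<close>\<close>
    with ln have ne: "expectation X \<noteq> 0" by auto
    then have int: "integrable M X" using not_integrable_integral_eq by blast
    have "0 \<le> expectation X" unfolding X_def by simp
    with ne have "expectation X = exp (C * s powr \<alpha>)" by (simp flip: ln)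
    moreover have eq: "exp (- (s * J 1 \<omega>)) = exp (- (s * m)) * X \<omega>" for \<omega>
      by (simp add: X_def exp_add[symmetric] algebra_simps)
    ultimately show ?thesis using int by (simp add: eq exp_add[symmetric])
  qed (simp add: prob_space)
  have "((\<lambda>\<epsilon>. \<integral>\<omega>. exp (- (s1 * (r / C) powr inverse (\<alpha> - 1) * Q1 \<epsilon> \<omega>) - s2 * (\<epsilon> / C) powr inverse (\<alpha> - 1) * Q2 \<epsilon> \<omega>) \<partial>N \<epsilon>)
           \<longlongrightarrow> 1 / (1 + s1 powr (\<alpha> - 1)) * (1 / (1 + s2 powr (\<alpha> - 1)))) (at_right 0)"
    by (rule stable_heavy_traffic[OF alpha C0 r _ _ stationary[folded m_def] s]) (use moment in auto)
  then show ?thesis by (simp add: beta)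
qed

end
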